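(* Let $\Gamma$ be a countable simplicial graph with vertex set $V\Gamma$ and let $\mathfrak{G}=\{G_v\mid v\in V\Gamma\}$ be a collection of discrete groups with the Haagerup property. Then the graph product $G=\Gamma\mathfrak{G}$, equipped with the discrete topology, has the Haagerup property.
   Context: A simplicial graph is a graph without loops or multiple edges; an edge is a 2-element subset of the vertex set. The graph product $\Gamma\mathfrak{G}$ of a collection of groups $\mathfrak{G}=\{G_v\mid v\in V\Gamma\}$ with respect to $\Gamma$ is the group obtained from the free product of the $G_v$, $v\in V\Gamma$, by adding the relations $[g_v,g_u]=1$ for all $g_v\in G_v$, $g_u\in G_u$ such that $\{v,u\}$ is an edge of $\Gamma$. A locally compact second countable group $H$ has the Haagerup property if there is an affine isometric action of $H$ on a Hilbert space such that the orbit map $b\colon g\mapsto g\cdot 0$ is proper, i.e. for every $M\geq 0$ there is a compact $K\subset H$ with $\|b(g)\|\geq M$ for all $g\in H\setminus K$. For discrete (countable) groups, compact subsets are the finite subsets. *)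

theory Defs
  imports
    "HOL-Analysis.Abstract_Metric_Spaces"
    "HOL-Algebra.Module"
    "HOL-Algebra.Group_Action"
begin

section \<open>Graph products of groups\<close>

definition simplicial_graph :: "'v set \<Rightarrow> 'v set set \<Rightarrow> bool" where
  "simplicial_graph V E \<longleftrightarrow> (\<forall>e\<in>E. e \<subseteq> V \<and> card e = 2)"

definition syllable_words :: "'v set \<Rightarrow> ('v \<Rightarrow> ('a, 'm) monoid_scheme) \<Rightarrow> ('v \<times> 'a) list set" where
  "syllable_words V G = lists (SIGMA v:V. carrier (G v))"

text \<open>The free product is the quotient of the free monoid on the disjoint union of the groups by
  the least congruence that deletes neutral syllables and multiplies adjacent syllables taken from
  the same group.\<close>

inductive_set free_product_rel ::
    "'v set \<Rightarrow> ('v \<Rightarrow> ('a, 'm) monoid_scheme) \<Rightarrow> (('v \<times> 'a) list \<times> ('v \<times> 'a) list) set"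
  for V :: "'v set" and G :: "'v \<Rightarrow> ('a, 'm) monoid_scheme"
where
  refl: "w \<in> syllable_words V G \<Longrightarrow> (w, w) \<in> free_product_rel V G"
| sym: "(w, w') \<in> free_product_rel V G \<Longrightarrow> (w', w) \<in> free_product_rel V G"
| trans: "\<lbrakk>(w, w') \<in> free_product_rel V G; (w', w'') \<in> free_product_rel V G\<rbrakk>
    \<Longrightarrow> (w, w'') \<in> free_product_rel V G"
| one: "\<lbrakk>v \<in> V; xs \<in> syllable_words V G; ys \<in> syllable_words V G\<rbrakk>
    \<Longrightarrow> (xs @ [(v, \<one>\<^bsub>G v\<^esub>)] @ ys, xs @ ys) \<in> free_product_rel V G"
| mult: "\<lbrakk>v \<in> V; g \<in> carrier (G v); h \<in> carrier (G v);
      xs \<in> syllable_words V G; ys \<in> syllable_words V G\<rbrakk>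
    \<Longrightarrow> (xs @ [(v, g), (v, h)] @ ys, xs @ [(v, g \<otimes>\<^bsub>G v\<^esub> h)] @ ys) \<in> free_product_rel V G"

definition free_product ::
    "'v set \<Rightarrow> ('v \<Rightarrow> ('a, 'm) monoid_scheme) \<Rightarrow> ('v \<times> 'a) list set monoid" where
  "free_product V G =
    \<lparr>carrier = syllable_words V G // free_product_rel V G,
     mult = (\<lambda>X Y. \<Union>x\<in>X. \<Union>y\<in>Y. free_product_rel V G `` {x @ y}),
     one = free_product_rel V G `` {[]}\<rparr>"

definition free_product_incl ::
    "'v set \<Rightarrow> ('v \<Rightarrow> ('a, 'm) monoid_scheme) \<Rightarrow> 'v \<Rightarrow> 'a \<Rightarrow> ('v \<times> 'a) list set" where
  "free_product_incl V G v g = free_product_rel V G `` {[(v, g)]}"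

definition commutator :: "('a, 'm) monoid_scheme \<Rightarrow> 'a \<Rightarrow> 'a \<Rightarrow> 'a" where
  "commutator G x y = x \<otimes>\<^bsub>G\<^esub> y \<otimes>\<^bsub>G\<^esub> inv\<^bsub>G\<^esub> x \<otimes>\<^bsub>G\<^esub> inv\<^bsub>G\<^esub> y"

definition normal_closure :: "('a, 'm) monoid_scheme \<Rightarrow> 'a set \<Rightarrow> 'a set" where
  "normal_closure G S = \<Inter>{N. N \<lhd> G \<and> S \<subseteq> N}"

definition graph_product_relators ::
    "'v set \<Rightarrow> 'v set set \<Rightarrow> ('v \<Rightarrow> ('a, 'm) monoid_scheme) \<Rightarrow> ('v \<times> 'a) list set set" where
  "graph_product_relators V E G =
    {commutator (free_product V G) (free_product_incl V G v g) (free_product_incl V G u h) | v u g h.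
      v \<in> V \<and> u \<in> V \<and> {v, u} \<in> E \<and> g \<in> carrier (G v) \<and> h \<in> carrier (G u)}"

definition graph_product ::
    "'v set \<Rightarrow> 'v set set \<Rightarrow> ('v \<Rightarrow> ('a, 'm) monoid_scheme) \<Rightarrow> ('v \<times> 'a) list set set monoid" where
  "graph_product V E G =
    free_product V G Mod normal_closure (free_product V G) (graph_product_relators V E G)"

lemma free_product_rel_words:
  assumes "(w, w') \<in> free_product_rel V G" and "\<And>v. v \<in> V \<Longrightarrow> group (G v)"
  shows "w \<in> syllable_words V G \<and> w' \<in> syllable_words V G"
  using assms(1)
proof induction
  case (one v xs ys)
  then show ?case
    using group.is_monoid[OF assms(2)[of v]] by (auto simp: syllable_words_def monoid.one_closed)
next
  case (mult v g h xs ys)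
  then show ?case
    using group.is_monoid[OF assms(2)[of v]] by (auto simp: syllable_words_def monoid.m_closed)
qed auto

lemma equiv_free_product_rel:
  assumes "\<And>v. v \<in> V \<Longrightarrow> group (G v)"
  shows "equiv (syllable_words V G) (free_product_rel V G)"
proof (rule equivI)
  show "free_product_rel V G \<subseteq> syllable_words V G \<times> syllable_words V G"
  proof (rule subrelI)
    fix w w' assume "(w, w') \<in> free_product_rel V G"
    then show "(w, w') \<in> syllable_words V G \<times> syllable_words V G"
      using free_product_rel_words[of w w' V G] assms by blast
  qed
  show "refl_on (syllable_words V G) (free_product_rel V G)"
    by (auto simp: refl_on_def intro: free_product_rel.refl)
  show "Relation.sym (free_product_rel V G)"
    by (rule symI) (rule free_product_rel.sym)
  show "Relation.trans (free_product_rel V G)"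
    by (rule transI) (rule free_product_rel.trans)
qed

lemma free_product_rel_append:
  assumes "(w, w') \<in> free_product_rel V G"
    and "xs \<in> syllable_words V G" "ys \<in> syllable_words V G"
  shows "(xs @ w @ ys, xs @ w' @ ys) \<in> free_product_rel V G"
  using assms(1)
proof induction
  case (refl w)
  then show ?case
    using assms(2,3) by (intro free_product_rel.refl) (auto simp: syllable_words_def)
next
  case (sym w w')
  show ?case by (rule free_product_rel.sym[OF sym.IH])
next
  case (trans w w' w'')
  show ?case by (rule free_product_rel.trans[OF trans.IH])
next
  case (one v as bs)
  then show ?case
    using free_product_rel.one[of v V "xs @ as" G "bs @ ys"] assms(2,3)
    by (auto simp: syllable_words_def)
next
  case (mult v g h as bs)
  then show ?case
    using free_product_rel.mult[of v V g G h "xs @ as" "bs @ ys"] assms(2,3)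
    by (auto simp: syllable_words_def)
qed

lemma group_free_product:
  assumes grp: "\<And>v. v \<in> V \<Longrightarrow> group (G v)"
  shows "group (free_product V G)"
proof -
  let ?W = "syllable_words V G" and ?R = "free_product_rel V G"
  have W_append: "x @ y \<in> ?W" if "x \<in> ?W" "y \<in> ?W" for x y
    using that by (auto simp: syllable_words_def)
  have W_Nil: "[] \<in> ?W"
    by (simp add: syllable_words_def)
  have eq: "equiv ?W ?R"
    by (rule equiv_free_product_rel[OF grp])
  have cong: "(x @ y, x' @ y') \<in> ?R" if "(x, x') \<in> ?R" "(y, y') \<in> ?R" for x x' y y'
  proof -
    have "x' \<in> ?W" "y \<in> ?W"
      using free_product_rel_words[OF that(1)] free_product_rel_words[OF that(2)] grp by blast+
    then have "(x @ y, x' @ y) \<in> ?R" "(x' @ y, x' @ y') \<in> ?R"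
      using free_product_rel_append[OF that(1) W_Nil, of y]
        free_product_rel_append[OF that(2) _ W_Nil, of x'] by auto
    then show ?thesis by (rule free_product_rel.trans)
  qed
  have resp: "congruent2 ?R ?R (\<lambda>x y. ?R `` {x @ y})"
    by (intro congruent2I' equiv_class_eq[OF eq] cong)
  have mult: "?R `` {x} \<otimes>\<^bsub>free_product V G\<^esub> ?R `` {y} = ?R `` {x @ y}"
    if "x \<in> ?W" "y \<in> ?W" for x y
    using UN_equiv_class2[OF eq eq resp that] by (simp add: free_product_def)
  have carrierE: "\<exists>x\<in>?W. X = ?R `` {x}" if "X \<in> carrier (free_product V G)" for X
    using that by (auto simp: free_product_def quotient_def)
  have carrierI: "?R `` {x} \<in> carrier (free_product V G)" if "x \<in> ?W" for x
    using that by (auto simp: free_product_def quotient_def)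
  have one: "\<one>\<^bsub>free_product V G\<^esub> = ?R `` {[]}"
    by (simp add: free_product_def)
  have inv: "\<exists>w'\<in>?W. (w' @ w, []) \<in> ?R" if "w \<in> ?W" for w
    using that unfolding syllable_words_def
  proof (induction w rule: lists.induct)
    case Nil
    then show ?case using W_Nil free_product_rel.refl by (auto simp: syllable_words_def)
  next
    case (Cons s w)
    then obtain w' where w': "w' \<in> ?W" "(w' @ w, []) \<in> ?R"
      by (auto simp: syllable_words_def)
    obtain v g where s: "s = (v, g)" "v \<in> V" "g \<in> carrier (G v)"
      using Cons by auto
    interpret Gv: group "G v" by (rule grp[OF s(2)])
    have w: "w \<in> ?W" and l: "[(v, inv\<^bsub>G v\<^esub> g)] \<in> ?W"
      using Cons s by (auto simp: syllable_words_def)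
    have "(w' @ [(v, inv\<^bsub>G v\<^esub> g), (v, g)] @ w, w' @ [(v, \<one>\<^bsub>G v\<^esub>)] @ w) \<in> ?R"
      using free_product_rel.mult[of v V "inv\<^bsub>G v\<^esub> g" G g w' w] s w w' by simp
    moreover have "(w' @ [(v, \<one>\<^bsub>G v\<^esub>)] @ w, w' @ w) \<in> ?R"
      by (rule free_product_rel.one[OF s(2) w'(1) w])
    ultimately have "(w' @ [(v, inv\<^bsub>G v\<^esub> g), (v, g)] @ w, []) \<in> ?R"
      by (metis w'(2) free_product_rel.trans)
    then have "((w' @ [(v, inv\<^bsub>G v\<^esub> g)]) @ s # w, []) \<in> ?R"
      by (simp add: s(1))
    moreover have "w' @ [(v, inv\<^bsub>G v\<^esub> g)] \<in> ?W"
      using W_append w'(1) l by blast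
    ultimately show ?case unfolding syllable_words_def by (rule bexI)
  qed
  show ?thesis
  proof (rule groupI)
    fix X Y assume "X \<in> carrier (free_product V G)" "Y \<in> carrier (free_product V G)"
    then obtain x y where "x \<in> ?W" "y \<in> ?W" "X = ?R `` {x}" "Y = ?R `` {y}"
      using carrierE[of X] carrierE[of Y] by blast
    then show "X \<otimes>\<^bsub>free_product V G\<^esub> Y \<in> carrier (free_product V G)"
      by (simp add: mult carrierI W_append)
  next
    show "\<one>\<^bsub>free_product V G\<^esub> \<in> carrier (free_product V G)"
      using carrierI[OF W_Nil] by (simp add: one)
  next
    fix X Y Z
    assume "X \<in> carrier (free_product V G)" "Y \<in> carrier (free_product V G)"
      "Z \<in> carrier (free_product V G)"
    then obtain x y z where "x \<in> ?W" "y \<in> ?W" "z \<in> ?W"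
      and "X = ?R `` {x}" "Y = ?R `` {y}" "Z = ?R `` {z}"
      using carrierE[of X] carrierE[of Y] carrierE[of Z] by blast
    then show "X \<otimes>\<^bsub>free_product V G\<^esub> Y \<otimes>\<^bsub>free_product V G\<^esub> Z =
        X \<otimes>\<^bsub>free_product V G\<^esub> (Y \<otimes>\<^bsub>free_product V G\<^esub> Z)"
      by (simp add: mult W_append)
  next
    fix X assume "X \<in> carrier (free_product V G)"
    then obtain x where x: "x \<in> ?W" "X = ?R `` {x}"
      using carrierE by blast
    show "\<one>\<^bsub>free_product V G\<^esub> \<otimes>\<^bsub>free_product V G\<^esub> X = X"
      using x W_Nil by (simp add: one mult)
    obtain w' where "w' \<in> ?W" "(w' @ x, []) \<in> ?R"
      using inv[OF x(1)] by blast
    then show "\<exists>Y\<in>carrier (free_product V G). Y \<otimes>\<^bsub>free_product V G\<^esub> X = \<one>\<^bsub>free_product V G\<^esub>"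
      using x carrierI[of w'] equiv_class_eq[OF eq, of "w' @ x" "[]"]
      by (intro bexI[of _ "?R `` {w'}"]) (simp_all add: one mult)
  qed
qed

section \<open>Hilbert spaces\<close>

text \<open>The definition of the Haagerup property quantifies existentially over Hilbert spaces, so these
  have to be terms and not instances of type classes. The ring multiplication and unit that are
  inherited from the module record play no role and are arbitrary.\<close>

abbreviation real_field :: "real ring" where
  "real_field \<equiv> \<lparr>carrier = UNIV, monoid.mult = (*), one = 1, zero = 0, add = (+)\<rparr>"

record 'h inner_module = "(real, 'h) module" +
  inner_prod :: "'h \<Rightarrow> 'h \<Rightarrow> real"

definition ip_norm :: "('h, 'm) inner_module_scheme \<Rightarrow> 'h \<Rightarrow> real" where
  "ip_norm H x = sqrt (inner_prod H x x)"

text \<open>The library's metric spaces require symmetry and nonnegativity also outside the carrier.\<close>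

definition ip_dist :: "('h, 'm) inner_module_scheme \<Rightarrow> 'h \<Rightarrow> 'h \<Rightarrow> real" where
  "ip_dist H x y = (if x \<in> carrier H \<and> y \<in> carrier H then ip_norm H (x \<ominus>\<^bsub>H\<^esub> y) else 0)"

locale real_inner_space = Module.module real_field H
  for H :: "('h, 'm) inner_module_scheme" (structure) +
  assumes inner_commute:
      "\<lbrakk>x \<in> carrier H; y \<in> carrier H\<rbrakk> \<Longrightarrow> inner_prod H x y = inner_prod H y x"
    and inner_add_left:
      "\<lbrakk>x \<in> carrier H; y \<in> carrier H; z \<in> carrier H\<rbrakk>
        \<Longrightarrow> inner_prod H (x \<oplus>\<^bsub>H\<^esub> y) z = inner_prod H x z + inner_prod H y z"
    and inner_smult_left:
      "\<lbrakk>x \<in> carrier H; y \<in> carrier H\<rbrakk>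
        \<Longrightarrow> inner_prod H (a \<odot>\<^bsub>H\<^esub> x) y = a * inner_prod H x y"
    and inner_nonneg: "x \<in> carrier H \<Longrightarrow> 0 \<le> inner_prod H x x"
    and inner_eq_zero: "\<lbrakk>x \<in> carrier H; inner_prod H x x = 0\<rbrakk> \<Longrightarrow> x = \<zero>\<^bsub>H\<^esub>"

lemma (in real_inner_space) Metric_space_ip_dist: "Metric_space (carrier H) (ip_dist H)"
proof -
  have add_right: "inner_prod H z (x \<oplus>\<^bsub>H\<^esub> y) = inner_prod H z x + inner_prod H z y"
    if "x \<in> carrier H" "y \<in> carrier H" "z \<in> carrier H" for x y z
    using that inner_commute[of z "x \<oplus>\<^bsub>H\<^esub> y"] inner_commute[of z x] inner_commute[of z y]
      inner_add_left[of x y z] by simp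
  have smult_right: "inner_prod H z (a \<odot>\<^bsub>H\<^esub> x) = a * inner_prod H z x"
    if "x \<in> carrier H" "z \<in> carrier H" for a x z
    using that inner_commute[of z "a \<odot>\<^bsub>H\<^esub> x"] inner_commute[of z x]
      inner_smult_left[of x z a] smult_closed[of a x] by simp
  have expand: "inner_prod H (x \<oplus>\<^bsub>H\<^esub> t \<odot>\<^bsub>H\<^esub> y) (x \<oplus>\<^bsub>H\<^esub> t \<odot>\<^bsub>H\<^esub> y) =
      inner_prod H x x + 2 * t * inner_prod H x y + t\<^sup>2 * inner_prod H y y"
    if x: "x \<in> carrier H" and y: "y \<in> carrier H" for x y t
  proof -
    have ty: "t \<odot>\<^bsub>H\<^esub> y \<in> carrier H" using y smult_closed[of t y] by simp
    show ?thesis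
      using x y ty inner_commute[OF x y]
      by (simp add: inner_add_left add_right inner_smult_left smult_right power2_eq_square
          distrib_left mult.assoc)
  qed
  have cs: "(inner_prod H x y)\<^sup>2 \<le> inner_prod H x x * inner_prod H y y"
    if x: "x \<in> carrier H" and y: "y \<in> carrier H" for x y
  proof (cases "inner_prod H y y = 0")
    case True
    have zero: "inner_prod H x \<zero>\<^bsub>H\<^esub> = 0"
      using add_right[of "\<zero>\<^bsub>H\<^esub>" "\<zero>\<^bsub>H\<^esub>" x] x by simp
    then have "inner_prod H x y = 0" using inner_eq_zero[OF y True] by simp
    then show ?thesis using True by simp
  next
    case False
    let ?t = "- inner_prod H x y / inner_prod H y y"
    have pos: "0 < inner_prod H y y" using False inner_nonneg[OF y] by simp
    have "0 \<le> inner_prod H x x + 2 * ?t * inner_prod H x y + ?t\<^sup>2 * inner_prod H y y"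
      using expand[OF x y, of ?t] inner_nonneg[of "x \<oplus>\<^bsub>H\<^esub> ?t \<odot>\<^bsub>H\<^esub> y"] x y
        smult_closed[of ?t y] by simp
    also have "\<dots> = inner_prod H x x - (inner_prod H x y)\<^sup>2 / inner_prod H y y"
      using pos by (simp add: field_simps power2_eq_square)
    finally show ?thesis using pos by (simp add: field_simps)
  qed
  have tri: "ip_norm H (x \<oplus>\<^bsub>H\<^esub> y) \<le> ip_norm H x + ip_norm H y"
    if x: "x \<in> carrier H" and y: "y \<in> carrier H" for x y
  proof -
    have "inner_prod H x y \<le> ip_norm H x * ip_norm H y"
      using real_le_rsqrt[OF cs[OF x y]] by (simp add: ip_norm_def real_sqrt_mult)
    moreover have "inner_prod H (x \<oplus>\<^bsub>H\<^esub> y) (x \<oplus>\<^bsub>H\<^esub> y) =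
        inner_prod H x x + 2 * inner_prod H x y + inner_prod H y y"
      using x y inner_commute[OF x y] by (simp add: inner_add_left add_right)
    ultimately have "inner_prod H (x \<oplus>\<^bsub>H\<^esub> y) (x \<oplus>\<^bsub>H\<^esub> y) \<le> (ip_norm H x + ip_norm H y)\<^sup>2"
      using inner_nonneg[OF x] inner_nonneg[OF y] by (simp add: ip_norm_def power2_sum)
    then show ?thesis
      using inner_nonneg[OF x] inner_nonneg[OF y]
      by (subst ip_norm_def) (intro real_le_lsqrt, auto simp: ip_norm_def)
  qed
  have norm_minus: "ip_norm H (x \<ominus>\<^bsub>H\<^esub> y) = ip_norm H (y \<ominus>\<^bsub>H\<^esub> x)"
    if x: "x \<in> carrier H" and y: "y \<in> carrier H" for x y
  proof -
    have neg: "inner_prod H (\<ominus>\<^bsub>H\<^esub> z) w = - inner_prod H z w"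
      if z: "z \<in> carrier H" and w: "w \<in> carrier H" for z w
    proof -
      have "inner_prod H (\<zero>\<^bsub>H\<^esub> \<oplus>\<^bsub>H\<^esub> \<zero>\<^bsub>H\<^esub>) w = 2 * inner_prod H \<zero>\<^bsub>H\<^esub> w"
        using w by (subst inner_add_left) simp_all
      then have "inner_prod H \<zero>\<^bsub>H\<^esub> w = 0" by simp
      moreover have "inner_prod H (\<ominus>\<^bsub>H\<^esub> z \<oplus>\<^bsub>H\<^esub> z) w = inner_prod H (\<ominus>\<^bsub>H\<^esub> z) w + inner_prod H z w"
        using z w by (subst inner_add_left) simp_all
      ultimately show ?thesis using z by (simp add: M.l_neg)
    qed
    have "y \<ominus>\<^bsub>H\<^esub> x = \<ominus>\<^bsub>H\<^esub> (x \<ominus>\<^bsub>H\<^esub> y)"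
      using x y by (simp add: M.minus_eq M.minus_add M.a_comm[of "\<ominus>\<^bsub>H\<^esub> x" y])
    moreover have "inner_prod H (\<ominus>\<^bsub>H\<^esub> z) (\<ominus>\<^bsub>H\<^esub> z) = inner_prod H z z" if z: "z \<in> carrier H" for z
      using z neg[OF z, of "\<ominus>\<^bsub>H\<^esub> z"] neg[OF z z] inner_commute[of z "\<ominus>\<^bsub>H\<^esub> z"] by simp
    ultimately show ?thesis using x y by (simp add: ip_norm_def)
  qed
  have zero_iff: "ip_norm H (x \<ominus>\<^bsub>H\<^esub> y) = 0 \<longleftrightarrow> x = y"
    if x: "x \<in> carrier H" and y: "y \<in> carrier H" for x y
  proof
    assume "ip_norm H (x \<ominus>\<^bsub>H\<^esub> y) = 0"
    then show "x = y"
      using inner_eq_zero[of "x \<ominus>\<^bsub>H\<^esub> y"] x y M.minus_equality[of x "\<ominus>\<^bsub>H\<^esub> y"]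
      by (simp add: ip_norm_def M.minus_eq)
  next
    assume "x = y"
    have "inner_prod H (\<zero>\<^bsub>H\<^esub> \<oplus>\<^bsub>H\<^esub> \<zero>\<^bsub>H\<^esub>) \<zero>\<^bsub>H\<^esub> = 2 * inner_prod H \<zero>\<^bsub>H\<^esub> \<zero>\<^bsub>H\<^esub>"
      by (subst inner_add_left) simp_all
    then show "ip_norm H (x \<ominus>\<^bsub>H\<^esub> y) = 0"
      using \<open>x = y\<close> y by (simp add: ip_norm_def M.minus_eq M.r_neg)
  qed
  show ?thesis
  proof (rule Metric_space.intro)
    show "0 \<le> ip_dist H x y" for x y
      using inner_nonneg[of "x \<ominus>\<^bsub>H\<^esub> y"] by (simp add: ip_dist_def ip_norm_def)
    show "ip_dist H x y = ip_dist H y x" for x y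
      unfolding ip_dist_def using norm_minus[of x y] by argo
    show "ip_dist H x y = 0 \<longleftrightarrow> x = y" if "x \<in> carrier H" "y \<in> carrier H" for x y
      using zero_iff[OF that] that by (simp add: ip_dist_def)
    show "ip_dist H x z \<le> ip_dist H x y + ip_dist H y z"
      if xyz: "x \<in> carrier H" "y \<in> carrier H" "z \<in> carrier H" for x y z
    proof -
      have "\<ominus>\<^bsub>H\<^esub> y \<oplus>\<^bsub>H\<^esub> (y \<oplus>\<^bsub>H\<^esub> \<ominus>\<^bsub>H\<^esub> z) = \<ominus>\<^bsub>H\<^esub> z"
        using xyz by (intro M.r_neg1) simp_all
      then have "(x \<ominus>\<^bsub>H\<^esub> y) \<oplus>\<^bsub>H\<^esub> (y \<ominus>\<^bsub>H\<^esub> z) = x \<ominus>\<^bsub>H\<^esub> z"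
        using xyz by (simp add: M.minus_eq M.a_assoc)
      then show ?thesis
        using tri[of "x \<ominus>\<^bsub>H\<^esub> y" "y \<ominus>\<^bsub>H\<^esub> z"] xyz by (simp add: ip_dist_def)
    qed
  qed
qed

locale real_hilbert_space = real_inner_space H
  for H :: "('h, 'm) inner_module_scheme" (structure) +
  assumes complete: "Metric_space.mcomplete (carrier H) (ip_dist H)"

section \<open>The Haagerup property\<close>

locale lcsc_group = group G for G :: "('a, 'm) monoid_scheme" (structure) and T :: "'a topology" +
  assumes topspace: "topspace T = carrier G"
    and continuous_mult: "continuous_map (prod_topology T T) T (\<lambda>(x, y). x \<otimes>\<^bsub>G\<^esub> y)"
    and continuous_inv: "continuous_map T T (\<lambda>x. inv\<^bsub>G\<^esub> x)"
    and hausdorff: "Hausdorff_space T"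
    and locally_compact: "locally_compact_space T"
    and second_countable: "second_countable T"

text \<open>For an action by isometries, continuity of the orbit maps is the same as joint continuity.\<close>

definition affine_isometric_action ::
    "('a, 'm) monoid_scheme \<Rightarrow> 'a topology \<Rightarrow> ('h, 'n) inner_module_scheme \<Rightarrow> ('a \<Rightarrow> 'h \<Rightarrow> 'h) \<Rightarrow> bool"
where
  "affine_isometric_action G T H \<alpha> \<longleftrightarrow>
    group_action G (carrier H) \<alpha> \<and>
    (\<forall>g\<in>carrier G. \<forall>x\<in>carrier H. \<forall>y\<in>carrier H. \<forall>t::real.
      \<alpha> g ((1 - t) \<odot>\<^bsub>H\<^esub> x \<oplus>\<^bsub>H\<^esub> t \<odot>\<^bsub>H\<^esub> y) = (1 - t) \<odot>\<^bsub>H\<^esub> \<alpha> g x \<oplus>\<^bsub>H\<^esub> t \<odot>\<^bsub>H\<^esub> \<alpha> g y) \<and>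
    (\<forall>g\<in>carrier G. \<forall>x\<in>carrier H. \<forall>y\<in>carrier H. ip_dist H (\<alpha> g x) (\<alpha> g y) = ip_dist H x y) \<and>
    (\<forall>x\<in>carrier H. continuous_map T (Metric_space.mtopology (carrier H) (ip_dist H)) (\<lambda>g. \<alpha> g x))"

definition proper_orbit_map ::
    "('a, 'm) monoid_scheme \<Rightarrow> 'a topology \<Rightarrow> ('h, 'n) inner_module_scheme \<Rightarrow> ('a \<Rightarrow> 'h \<Rightarrow> 'h) \<Rightarrow> bool"
where
  "proper_orbit_map G T H \<alpha> \<longleftrightarrow>
    (\<forall>M\<ge>0. \<exists>K. compactin T K \<and> (\<forall>g\<in>carrier G - K. M \<le> ip_norm H (\<alpha> g \<zero>\<^bsub>H\<^esub>)))"

text \<open>HOL cannot quantify over types, so the type from which the elements of the Hilbert space are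
  drawn is a parameter. Restricting an action to the closed linear span of the orbit of the origin
  shows that a separable Hilbert space always suffices, and every separable Hilbert space has an
  isomorphic copy whose carrier is a set of sequences; hence the property at type
  \<^typ>\<open>nat \<Rightarrow> real\<close> is implied by the property at any other type.\<close>

definition haagerup :: "'h itself \<Rightarrow> ('a, 'm) monoid_scheme \<Rightarrow> 'a topology \<Rightarrow> bool" where
  "haagerup U G T \<longleftrightarrow> lcsc_group G T \<and>
    (\<exists>(H :: 'h inner_module) \<alpha>.
      real_hilbert_space H \<and> affine_isometric_action G T H \<alpha> \<and> proper_orbit_map G T H \<alpha>)"

end

theory Submission
  imports Defs
begin

text \<open>For a countable discrete group \<open>H\<close>, a proper affine isometric action on a Hilbert space is the same
  as a proper function \<open>K\<close> of two group elements that looks like \<open>K g h = \<langle>b g, b h\<rangle>\<close> for the orbit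
  \<open>b g = g \<cdot> 0\<close>: it is positive semidefinite, it vanishes when one argument is neutral, and the squared
  distance \<open>K g g + K h h - 2 K g h\<close> is invariant under left multiplication
  (\<open>haagerup_imp_proper_orbit_kernel\<close> and \<open>proper_orbit_kernel_imp_haagerup\<close>). Kernels carry no reference
  to a type of vectors, so the Hilbert spaces of the vertex groups can be left behind at once, and it
  remains to assemble a kernel on the graph product from kernels \<open>K\<^sub>v\<close> on the vertex groups.
  
  The Cayley graph of the graph product with respect to all syllables is divided by walls. A syllable
  of \<open>G\<^sub>v\<close> read at the point \<open>p\<close> crosses the wall \<open>(v, p\<langle>star v\<rangle>)\<close>, where \<open>\<langle>star v\<rangle>\<close> is the subgroup
  generated by \<open>G\<^sub>v\<close> and the vertex groups that commute with it: moving \<open>p\<close> along this subgroup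
  leaves the wall the same. Multiplying, in order, all syllables of a word that cross a given wall yields the
  coordinate of the word at this wall. None of the defining relations changes it
  (\<open>crossing_invariant\<close>), so group elements have coordinates, and left multiplication by \<open>x\<close> translates
  the walls and multiplies each coordinate from the left by a coordinate of \<open>x\<close> (\<open>coordinate_mult\<close>).
  Hence the sum over all walls of \<open>K\<^sub>v\<close>, evaluated at the coordinates of \<open>g\<close> and \<open>h\<close>, is again a
  kernel of the required form (\<open>orbit_kernel_product_kernel\<close>).
  
  A word of minimal length crosses every wall at most once: between two consecutive crossings of a wall, a
  shortest word uses only syllables that commute with \<open>G\<^sub>v\<close>, so the two syllables could be merged
  (\<open>distinct_crossed_walls_minimal_word\<close>). Therefore \<open>K g g\<close> is the sum of \<open>K\<^sub>v s s\<close> over the syllables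
  \<open>s\<close> of a shortest word for \<open>g\<close>. Before the construction the kernels \<open>K\<^sub>v\<close> are enlarged so that every
  nontrivial syllable contributes at least \<open>1\<close> and all but finitely many syllables contribute more than a
  given bound; then only finitely many \<open>g\<close> satisfy \<open>K g g \<le> M\<close> (\<open>proper_product_kernel\<close>).\<close>

section \<open>The Hilbert space of square-summable sequences\<close>

text \<open>The Hilbert space has to consist of sequences in the end, but closures, spans and completeness are
  available for type classes. A type of square-summable sequences gives access to them; its closed
  subspaces are turned into records only when the action is built.\<close>

typedef ell2 = "{x :: nat \<Rightarrow> real. summable (\<lambda>n. (x n)\<^sup>2)}"
  morphisms coord Abs_ell2
  by (rule exI[of _ "\<lambda>_. 0"]) simp

setup_lifting type_definition_ell2

lemma summable_coord_square: "summable (\<lambda>n. (coord x n)\<^sup>2)"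
  using coord[of x] by simp

lemma summable_mult_of_squares:
  fixes x y :: "nat \<Rightarrow> real"
  assumes "summable (\<lambda>n. (x n)\<^sup>2)" "summable (\<lambda>n. (y n)\<^sup>2)"
  shows "summable (\<lambda>n. x n * y n)"
proof (rule summable_comparison_test'[where N = 0])
  show "summable (\<lambda>n. (x n)\<^sup>2 + (y n)\<^sup>2)"
    using assms by (rule summable_add)
  show "norm (x n * y n) \<le> (x n)\<^sup>2 + (y n)\<^sup>2" for n
  proof -
    have "2 * (\<bar>x n\<bar> * \<bar>y n\<bar>) \<le> (x n)\<^sup>2 + (y n)\<^sup>2"
      using sum_squares_bound[of "\<bar>x n\<bar>" "\<bar>y n\<bar>"] by (simp add: mult.assoc)
    moreover have "0 \<le> \<bar>x n\<bar> * \<bar>y n\<bar>" by simp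
    ultimately show ?thesis unfolding real_norm_def abs_mult by linarith
  qed
qed

lemma summable_square_add:
  fixes x y :: "nat \<Rightarrow> real"
  assumes "summable (\<lambda>n. (x n)\<^sup>2)" "summable (\<lambda>n. (y n)\<^sup>2)"
  shows "summable (\<lambda>n. (x n + y n)\<^sup>2)"
proof -
  have "summable (\<lambda>n. (x n)\<^sup>2 + (y n)\<^sup>2 + 2 * (x n * y n))"
    by (intro summable_add summable_mult summable_mult_of_squares assms)
  then show ?thesis by (simp add: power2_sum mult.assoc)
qed

instantiation ell2 :: real_inner
begin

lift_definition zero_ell2 :: ell2 is "\<lambda>_. 0" by simp

lift_definition plus_ell2 :: "ell2 \<Rightarrow> ell2 \<Rightarrow> ell2" is "\<lambda>x y n. x n + y n"
  by (rule summable_square_add)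

lift_definition uminus_ell2 :: "ell2 \<Rightarrow> ell2" is "\<lambda>x n. - x n" by simp

lift_definition minus_ell2 :: "ell2 \<Rightarrow> ell2 \<Rightarrow> ell2" is "\<lambda>x y n. x n - y n"
  subgoal for x y using summable_square_add[of x "\<lambda>n. - y n"] by simp
  done

lift_definition scaleR_ell2 :: "real \<Rightarrow> ell2 \<Rightarrow> ell2" is "\<lambda>a x n. a * x n"
  by (simp add: power_mult_distrib summable_mult)

lift_definition inner_ell2 :: "ell2 \<Rightarrow> ell2 \<Rightarrow> real" is "\<lambda>x y. \<Sum>n. x n * y n" .

definition norm_ell2 :: "ell2 \<Rightarrow> real" where "norm_ell2 x = sqrt (inner x x)"

definition dist_ell2 :: "ell2 \<Rightarrow> ell2 \<Rightarrow> real" where "dist_ell2 x y = norm (x - y)"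

definition sgn_ell2 :: "ell2 \<Rightarrow> ell2" where "sgn_ell2 x = scaleR (inverse (norm x)) x"

definition uniformity_ell2 :: "(ell2 \<times> ell2) filter" where
  "uniformity_ell2 = (INF e\<in>{0<..}. principal {(x, y). dist x y < e})"

definition open_ell2 :: "ell2 set \<Rightarrow> bool" where
  "open_ell2 U = (\<forall>x\<in>U. \<forall>\<^sub>F (x', y) in uniformity. x' = x \<longrightarrow> y \<in> U)"

instance
proof
  fix x y z :: ell2 and a b :: real and U :: "ell2 set"
  show "x + y + z = x + (y + z)" by transfer auto
  show "x + y = y + x" by transfer auto
  show "0 + x = x" by transfer auto
  show "- x + x = 0" by transfer auto
  show "x - y = x + - y" by transfer auto
  show "a *\<^sub>R (x + y) = a *\<^sub>R x + a *\<^sub>R y" by transfer (auto simp: algebra_simps)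
  show "(a + b) *\<^sub>R x = a *\<^sub>R x + b *\<^sub>R x" by transfer (auto simp: algebra_simps)
  show "a *\<^sub>R b *\<^sub>R x = (a * b) *\<^sub>R x" by transfer auto
  show "1 *\<^sub>R x = x" by transfer auto
  show "dist x y = norm (x - y)" by (rule dist_ell2_def)
  show "sgn x = scaleR (inverse (norm x)) x" by (rule sgn_ell2_def)
  show "uniformity = (INF e\<in>{0<..}. principal {(x :: ell2, y). dist x y < e})"
    by (rule uniformity_ell2_def)
  show "open U = (\<forall>x\<in>U. \<forall>\<^sub>F (x', y) in uniformity. x' = x \<longrightarrow> y \<in> U)"
    by (rule open_ell2_def)
  show "inner x y = inner y x" by transfer (simp add: mult.commute)
  show "inner (x + y) z = inner x z + inner y z"
    by transfer (simp add: distrib_right suminf_add summable_mult_of_squares)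
  show "inner (a *\<^sub>R x) y = a * inner x y"
    by transfer (simp add: suminf_mult summable_mult_of_squares mult.assoc)
  show "0 \<le> inner x x"
    by transfer (simp add: suminf_nonneg flip: power2_eq_square)
  show "inner x x = 0 \<longleftrightarrow> x = 0"
    by transfer (auto simp: suminf_eq_zero_iff fun_eq_iff simp flip: power2_eq_square)
  show "norm x = sqrt (inner x x)" by (rule norm_ell2_def)
qed

end

lemma norm_ell2_square: "(norm x)\<^sup>2 = (\<Sum>n. (coord x n)\<^sup>2)"
  by (simp add: power2_norm_eq_inner inner_ell2.rep_eq flip: power2_eq_square)

lemma sum_coord_square_le_norm: "(\<Sum>n<N. (coord x n)\<^sup>2) \<le> (norm x)\<^sup>2"
  unfolding norm_ell2_square by (rule sum_le_suminf) (auto simp: summable_coord_square)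

lemma abs_coord_le_norm: "\<bar>coord x n\<bar> \<le> norm x"
proof -
  have "(coord x n)\<^sup>2 \<le> (\<Sum>m<Suc n. (coord x m)\<^sup>2)"
    by (simp add: sum_nonneg)
  then have "(coord x n)\<^sup>2 \<le> (norm x)\<^sup>2"
    using sum_coord_square_le_norm[where N = "Suc n" and x = x] by linarith
  then show ?thesis by (simp add: abs_le_square_iff[symmetric])
qed

instance ell2 :: banach
proof
  fix X :: "nat \<Rightarrow> ell2"
  assume X: "Cauchy X"
  have coord_diff: "coord (x - y) n = coord x n - coord y n" for x y n
    by (simp add: minus_ell2.rep_eq)
  have "Cauchy (\<lambda>k. coord (X k) n)" for n
    unfolding Cauchy_def
  proof (intro allI impI)
    fix e :: real assume "0 < e"
    then obtain M where M: "\<And>k m. M \<le> k \<Longrightarrow> M \<le> m \<Longrightarrow> norm (X k - X m) < e"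
      using X unfolding Cauchy_def dist_norm by blast
    have "dist (coord (X k) n) (coord (X m) n) < e" if "M \<le> k" "M \<le> m" for k m
      using abs_coord_le_norm[of "X k - X m" n] M[OF that] by (simp add: coord_diff dist_real_def)
    then show "\<exists>M. \<forall>k\<ge>M. \<forall>m\<ge>M. dist (coord (X k) n) (coord (X m) n) < e" by blast
  qed
  then have "\<exists>l. (\<lambda>k. coord (X k) n) \<longlonglongrightarrow> l" for n
    by (simp add: real_Cauchy_convergent flip: convergent_def)
  then obtain l where l: "\<And>n. (\<lambda>k. coord (X k) n) \<longlonglongrightarrow> l n" by metis
  (* The bound survives the limit in the second index because it only involves finite sums. *)
  have bound: "(\<Sum>n<N. (coord (X k) n - l n)\<^sup>2) \<le> e\<^sup>2"
    if "\<And>m. M \<le> m \<Longrightarrow> norm (X k - X m) < e" for e k M N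
  proof (rule LIMSEQ_le_const2)
    show "(\<lambda>m. \<Sum>n<N. (coord (X k) n - coord (X m) n)\<^sup>2) \<longlonglongrightarrow> (\<Sum>n<N. (coord (X k) n - l n)\<^sup>2)"
      by (intro tendsto_intros l)
    have "(\<Sum>n<N. (coord (X k) n - coord (X m) n)\<^sup>2) \<le> e\<^sup>2" if "M \<le> m" for m
    proof -
      have "(norm (X k - X m))\<^sup>2 \<le> e\<^sup>2"
        using \<open>\<And>m. M \<le> m \<Longrightarrow> norm (X k - X m) < e\<close>[OF that] by (intro power_mono) auto
      then show ?thesis
        using sum_coord_square_le_norm[where N = N and x = "X k - X m"] by (simp add: coord_diff)
    qed
    then show "\<exists>M. \<forall>m\<ge>M. (\<Sum>n<N. (coord (X k) n - coord (X m) n)\<^sup>2) \<le> e\<^sup>2" by blast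
  qed
  have summable_diff: "summable (\<lambda>n. (coord (X k) n - l n)\<^sup>2)"
    and suminf_diff: "(\<Sum>n. (coord (X k) n - l n)\<^sup>2) \<le> e\<^sup>2"
    if "\<And>m. M \<le> m \<Longrightarrow> norm (X k - X m) < e" for e k M
  proof -
    show "summable (\<lambda>n. (coord (X k) n - l n)\<^sup>2)"
      by (rule bounded_imp_summable[where B = "e\<^sup>2"])
        (use bound[where N = "Suc _", OF that] in \<open>auto simp: lessThan_Suc_atMost\<close>)
    then show "(\<Sum>n. (coord (X k) n - l n)\<^sup>2) \<le> e\<^sup>2"
      by (rule suminf_le_const) (rule bound[OF that])
  qed
  obtain M1 where M1: "\<And>k m. M1 \<le> k \<Longrightarrow> M1 \<le> m \<Longrightarrow> norm (X k - X m) < 1"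
    using X unfolding Cauchy_def dist_norm by (metis zero_less_one)
  have "summable (\<lambda>n. (l n)\<^sup>2)"
  proof -
    have "summable (\<lambda>n. (coord (X M1) n - l n)\<^sup>2)"
      by (rule summable_diff[where M = M1 and e = 1]) (simp add: M1)
    then have "summable (\<lambda>n. (l n - coord (X M1) n)\<^sup>2)" by (simp add: power2_commute)
    from summable_square_add[OF this summable_coord_square[of "X M1"]] show ?thesis by simp
  qed
  then have coord_lim: "coord (Abs_ell2 l) = l" by (simp add: Abs_ell2_inverse)
  have "X \<longlonglongrightarrow> Abs_ell2 l"
    unfolding LIMSEQ_def dist_norm
  proof (intro allI impI)
    fix e :: real assume "0 < e"
    then obtain M where M: "\<And>k m. M \<le> k \<Longrightarrow> M \<le> m \<Longrightarrow> norm (X k - X m) < e / 2"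
      using X unfolding Cauchy_def dist_norm by (metis half_gt_zero)
    have "norm (X k - Abs_ell2 l) < e" if "M \<le> k" for k
    proof -
      have "(norm (X k - Abs_ell2 l))\<^sup>2 \<le> (e / 2)\<^sup>2"
        using suminf_diff[where M = M and e = "e / 2", OF M[OF that]]
        by (simp add: norm_ell2_square coord_diff coord_lim)
      then have "norm (X k - Abs_ell2 l) \<le> e / 2"
        by (rule power2_le_imp_le) (use \<open>0 < e\<close> in simp)
      then show ?thesis using \<open>0 < e\<close> by simp
    qed
    then show "\<exists>M. \<forall>k\<ge>M. norm (X k - Abs_ell2 l) < e" by blast
  qed
  then show "convergent X" by (rule convergentI)
qed

section \<open>Positive semidefinite kernels are Gram kernels\<close>

definition positive_semidefinite_on :: "'x set \<Rightarrow> ('x \<Rightarrow> 'x \<Rightarrow> real) \<Rightarrow> bool" where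
  "positive_semidefinite_on X K \<longleftrightarrow>
    (\<forall>x\<in>X. \<forall>y\<in>X. K x y = K y x) \<and>
    (\<forall>F c. finite F \<longrightarrow> F \<subseteq> X \<longrightarrow> 0 \<le> (\<Sum>x\<in>F. \<Sum>y\<in>F. c x * c y * K x y))"

lemma positive_semidefinite_on_commute:
  "positive_semidefinite_on X K \<Longrightarrow> x \<in> X \<Longrightarrow> y \<in> X \<Longrightarrow> K x y = K y x"
  by (simp add: positive_semidefinite_on_def)

lemma positive_semidefinite_onD:
  "positive_semidefinite_on X K \<Longrightarrow> finite F \<Longrightarrow> F \<subseteq> X \<Longrightarrow>
    0 \<le> (\<Sum>x\<in>F. \<Sum>y\<in>F. c x * c y * K x y)"
  by (simp add: positive_semidefinite_on_def)

lemma positive_semidefinite_on_diag_nonneg: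
  assumes "positive_semidefinite_on X K" "x \<in> X"
  shows "0 \<le> K x x"
  using positive_semidefinite_onD[OF assms(1), of "{x}" "\<lambda>_. 1"] assms(2) by simp

lemma positive_semidefinite_on_diag_zero:
  assumes K: "positive_semidefinite_on X K" and x: "x \<in> X" and z: "z \<in> X" and zero: "K z z = 0"
  shows "K x z = 0"
proof (rule ccontr)
  assume nz: "K x z \<noteq> 0"
  then have "x \<noteq> z" using zero by auto
  \<comment> \<open>Along \<open>z\<close> the quadratic form is affine, so it stays nonnegative only if its slope is zero.\<close>
  define t where "t = - (K x x + 1) / (2 * K x z)"
  have "0 \<le> K x x + 2 * t * K x z"
    using positive_semidefinite_onD[OF K, of "{x, z}" "\<lambda>u. if u = x then 1 else t"] x z \<open>x \<noteq> z\<close>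
      zero positive_semidefinite_on_commute[OF K x z] by (auto simp: algebra_simps)
  also have "2 * t * K x z = - (K x x + 1)"
    using nz by (simp add: t_def field_simps)
  finally show False by simp
qed

text \<open>One step of the Gram-Schmidt process, written in terms of inner products: the Gram kernel after
  projecting away from the vector with index \<open>z\<close>. If that vector has length zero, division by zero
  makes the step trivial, which is what is wanted.\<close>

definition schur_complement :: "('x \<Rightarrow> 'x \<Rightarrow> real) \<Rightarrow> 'x \<Rightarrow> 'x \<Rightarrow> 'x \<Rightarrow> real" where
  "schur_complement K z x y = K x y - K x z * K z y / K z z"

text \<open>Subtracting a multiple of the vector at \<open>z\<close> from a linear combination does not change its
  projection; choosing the multiple that minimises the quadratic form of \<open>K\<close> gives exactly the quadratic
  form of the complement.\<close>

lemma positive_semidefinite_on_schur_complement: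
  assumes K: "positive_semidefinite_on X K" and z: "z \<in> X"
  shows "positive_semidefinite_on X (schur_complement K z)"
proof (cases "K z z = 0")
  case True
  then have "schur_complement K z = K" by (simp add: schur_complement_def fun_eq_iff)
  then show ?thesis using K by simp
next
  case False
  note comm = positive_semidefinite_on_commute[OF K]
  show ?thesis
    unfolding positive_semidefinite_on_def
  proof (intro conjI ballI allI impI)
    fix x y assume "x \<in> X" "y \<in> X"
    then show "schur_complement K z x y = schur_complement K z y x"
      using comm[of x y] comm[of x z] comm[of y z] z by (simp add: schur_complement_def)
  next
    fix F and c :: "'a \<Rightarrow> real" assume F: "finite F" "F \<subseteq> X"
    define F' where "F' = insert z F"
    define c0 where "c0 u = (if u \<in> F then c u else 0)" for u
    define S where "S = (\<Sum>x\<in>F'. c0 x * K x z)"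
    \<comment> \<open>the minimiser of the quadratic form along the direction of \<open>z\<close>\<close>
    define t where "t = S / K z z"
    define d where "d u = c0 u - (if u = z then t else 0)" for u
    have F': "finite F'" "F' \<subseteq> X" "z \<in> F'" using F z by (auto simp: F'_def)
    have F_F': "(\<Sum>x\<in>F. c x * f x) = (\<Sum>x\<in>F'. c0 x * f x)" for f
      by (rule sum.mono_neutral_cong_left) (use F F' in \<open>auto simp: F'_def c0_def\<close>)
    have d: "(\<Sum>x\<in>F'. d x * f x) = (\<Sum>x\<in>F'. c0 x * f x) - t * f z" for f
    proof -
      have "(\<Sum>x\<in>F'. d x * f x) = (\<Sum>x\<in>F'. c0 x * f x - (if x = z then t * f z else 0))"
        by (rule sum.cong) (auto simp: d_def algebra_simps)
      then show ?thesis using F' by (simp add: sum_subtractf)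
    qed
    have S': "(\<Sum>y\<in>F'. c0 y * K z y) = S"
      unfolding S_def by (rule sum.cong) (use F' z comm in auto)
    have "0 \<le> (\<Sum>x\<in>F'. \<Sum>y\<in>F'. d x * d y * K x y)"
      by (rule positive_semidefinite_onD[OF K F'(1,2)])
    also have "\<dots> = (\<Sum>x\<in>F'. d x * (\<Sum>y\<in>F'. d y * K x y))"
      by (simp add: sum_distrib_left mult.assoc)
    also have "\<dots> = (\<Sum>x\<in>F'. c0 x * (\<Sum>y\<in>F'. c0 y * K x y)) - t * S - t * (S - t * K z z)"
      unfolding d by (simp add: right_diff_distrib sum_subtractf S' S_def sum_distrib_left mult_ac)
    also have "t * K z z = S" using False by (simp add: t_def)
    also have "(\<Sum>x\<in>F'. c0 x * (\<Sum>y\<in>F'. c0 y * K x y)) - t * S - t * (S - S) =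
        (\<Sum>x\<in>F'. c0 x * (\<Sum>y\<in>F'. c0 y * K x y)) - (\<Sum>x\<in>F'. c0 x * (\<Sum>y\<in>F'. c0 y * (K x z * K z y / K z z)))"
    proof -
      have "(\<Sum>x\<in>F'. c0 x * (\<Sum>y\<in>F'. c0 y * (K x z * K z y / K z z))) =
          (\<Sum>x\<in>F'. c0 x * K x z * ((\<Sum>y\<in>F'. c0 y * K z y) / K z z))"
        by (simp add: sum_distrib_left sum_divide_distrib mult_ac)
      also have "\<dots> = S * (S / K z z)"
        unfolding S' S_def sum_distrib_right ..
      finally show ?thesis by (simp add: t_def)
    qed
    also have "\<dots> = (\<Sum>x\<in>F'. c0 x * (\<Sum>y\<in>F'. c0 y * schur_complement K z x y))"
      by (simp add: schur_complement_def right_diff_distrib sum_subtractf)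
    also have "\<dots> = (\<Sum>x\<in>F. \<Sum>y\<in>F. c x * c y * schur_complement K z x y)"
      by (simp only: F_F'[symmetric]) (simp add: sum_distrib_left mult.assoc)
    finally show "0 \<le> (\<Sum>x\<in>F. \<Sum>y\<in>F. c x * c y * schur_complement K z x y)" .
  qed
qed

primrec iterated_schur :: "('x \<Rightarrow> 'x \<Rightarrow> real) \<Rightarrow> (nat \<Rightarrow> 'x) \<Rightarrow> nat \<Rightarrow> 'x \<Rightarrow> 'x \<Rightarrow> real" where
  "iterated_schur K f 0 = K"
| "iterated_schur K f (Suc n) = schur_complement (iterated_schur K f n) (f n)"

text \<open>Cholesky decomposition for an infinite kernel. The points of \<open>X\<close> are projected away one after the
  other; after its own turn a point has nothing left, so its vector of Cholesky coefficients has finite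
  support and no convergence question arises.\<close>

theorem positive_semidefinite_on_imp_ell2_embedding:
  assumes X: "countable X" and K: "positive_semidefinite_on X K"
  obtains b :: "'x \<Rightarrow> ell2" where "\<And>x y. x \<in> X \<Longrightarrow> y \<in> X \<Longrightarrow> inner (b x) (b y) = K x y"
proof (cases "X = {}")
  case True
  then show ?thesis using that by blast
next
  case False
  define f where "f = from_nat_into X"
  have f: "f n \<in> X" for n unfolding f_def by (rule from_nat_into[OF False])
  let ?R = "iterated_schur K f"
  have R: "positive_semidefinite_on X (?R n)" for n
    by (induction n) (simp_all add: K positive_semidefinite_on_schur_complement f)
  have R_zero: "?R N (f m) y = 0" if "m < N" "y \<in> X" for m N y
    using that
  proof (induction N arbitrary: y)
    case (Suc N)
    show ?case
    proof (cases "m = N")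
      case True
      then show ?thesis
        using positive_semidefinite_on_diag_zero[OF R \<open>y \<in> X\<close> f, of N N]
          positive_semidefinite_on_commute[OF R \<open>y \<in> X\<close> f, of N N]
        by (cases "?R N (f N) (f N) = 0") (simp_all add: schur_complement_def)
    next
      case False
      then have "m < N" using Suc.prems by simp
      then show ?thesis using Suc.IH Suc.prems(2) f by (simp add: schur_complement_def)
    qed
  qed simp
  define L where "L x n = ?R n x (f n) / sqrt (?R n (f n) (f n))" for x n
  have expand: "K x y = (\<Sum>n<N. L x n * L y n) + ?R N x y" if "x \<in> X" "y \<in> X" for x y N
  proof (induction N)
    case (Suc N)
    have "L x N * L y N = ?R N x (f N) * ?R N (f N) y / ?R N (f N) (f N)"
      using positive_semidefinite_on_diag_nonneg[OF R f, of N N]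
        positive_semidefinite_on_commute[OF R \<open>y \<in> X\<close> f, of N N]
      by (simp add: L_def)
    then show ?case using Suc by (simp add: schur_complement_def)
  qed simp
  have L_zero: "L (f m) n = 0" if "m < n" for m n
    using R_zero[OF that f] by (simp add: L_def)
  have coord_L: "coord (Abs_ell2 (L x)) = L x" if x: "x \<in> X" for x
  proof -
    obtain m where m: "x = f m"
      using x X unfolding f_def by (metis from_nat_into_surj)
    have "summable (\<lambda>n. (L x n)\<^sup>2)"
      by (rule summable_finite[of "{..m}"]) (use L_zero[of m] m in auto)
    then show ?thesis by (simp add: Abs_ell2_inverse)
  qed
  show ?thesis
  proof (rule that)
    fix x y assume x: "x \<in> X" and y: "y \<in> X"
    obtain m where m: "x = f m"
      using x X unfolding f_def by (metis from_nat_into_surj)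
    have "inner (Abs_ell2 (L x)) (Abs_ell2 (L y)) = (\<Sum>n. L x n * L y n)"
      using x y by (simp add: inner_ell2.rep_eq coord_L)
    also have "\<dots> = (\<Sum>n<Suc m. L x n * L y n)"
      by (rule suminf_finite) (use L_zero[of m] m in auto)
    also have "\<dots> = K x y"
      using expand[OF x y, of "Suc m"] R_zero[of m "Suc m" y] y m by simp
    finally show "inner (Abs_ell2 (L x)) (Abs_ell2 (L y)) = K x y" .
  qed
qed

section \<open>Linear isometries from equal Gram matrices\<close>

lemma subspace_closure:
  fixes S :: "'a::real_normed_vector set"
  assumes S: "subspace S"
  shows "subspace (closure S)"
proof (rule subspaceI)
  show "0 \<in> closure S"
    using subspace_0[OF S] closure_subset by blast
next
  fix x y assume "x \<in> closure S" "y \<in> closure S"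
  then obtain X Y where X: "\<And>n. X n \<in> S" "X \<longlonglongrightarrow> x" and Y: "\<And>n. Y n \<in> S" "Y \<longlonglongrightarrow> y"
    unfolding closure_sequential by metis
  have "(\<lambda>n. X n + Y n) \<longlonglongrightarrow> x + y" by (rule tendsto_add[OF X(2) Y(2)])
  then show "x + y \<in> closure S"
    unfolding closure_sequential using subspace_add[OF S X(1) Y(1)] by (intro exI[of _ "\<lambda>n. X n + Y n"]) auto
next
  fix a x assume "x \<in> closure S"
  then obtain X where X: "\<And>n. X n \<in> S" "X \<longlonglongrightarrow> x"
    unfolding closure_sequential by metis
  have "(\<lambda>n. a *\<^sub>R X n) \<longlonglongrightarrow> a *\<^sub>R x" by (intro tendsto_intros X)
  then show "a *\<^sub>R x \<in> closure S"
    unfolding closure_sequential using subspace_scale[OF S X(1)] by (intro exI[of _ "\<lambda>n. a *\<^sub>R X n"]) auto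
qed

text \<open>The graph of the isometry is constructed instead of the map: it is the closed subspace \<open>W\<close> of the
  product space spanned by the pairs \<open>(f i, f' i)\<close>. Both projections preserve the norm on it up to the
  factor \<open>\<surd>2\<close>, so the graph is single-valued and its domain is complete, hence contains the closed span
  of the vectors \<open>f i\<close>.\<close>

theorem linear_isometry_of_equal_gram_matrices:
  fixes f f' :: "'i \<Rightarrow> 'a::{real_inner,banach}"
  assumes gram: "\<And>i j. i \<in> I \<Longrightarrow> j \<in> I \<Longrightarrow> inner (f' i) (f' j) = inner (f i) (f j)"
  obtains T where
    "\<And>x. x \<in> closure (span (f ` I)) \<Longrightarrow> T x \<in> closure (span (f' ` I))"
    "\<And>x y. x \<in> closure (span (f ` I)) \<Longrightarrow> y \<in> closure (span (f ` I)) \<Longrightarrow> T (x + y) = T x + T y"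
    "\<And>a x. x \<in> closure (span (f ` I)) \<Longrightarrow> T (a *\<^sub>R x) = a *\<^sub>R T x"
    "\<And>x. x \<in> closure (span (f ` I)) \<Longrightarrow> norm (T x) = norm x"
    "\<And>i. i \<in> I \<Longrightarrow> T (f i) = f' i"
proof -
  define P where "P = (\<lambda>i. (f i, f' i)) ` I"
  define W where "W = closure (span P)"
  have W: "subspace W" unfolding W_def by (intro subspace_closure subspace_span)
  have P_W: "(f i, f' i) \<in> W" if "i \<in> I" for i
  proof -
    have "(f i, f' i) \<in> span P" using that by (intro span_base) (auto simp: P_def)
    then show ?thesis unfolding W_def using closure_subset by blast
  qed
  have inner_P: "inner (fst z) (fst w) = inner (snd z) (snd w)" if "z \<in> span P" "w \<in> P" for z w
    using that(1)
  proof (induction rule: span_induct)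
    case base
    show ?case
      by (auto simp: subspace_def inner_add_left)
  next
    case (step z)
    then show ?case using that(2) gram by (auto simp: P_def)
  qed
  have inner_span: "inner (fst z) (fst w) = inner (snd z) (snd w)"
    if "w \<in> span P" "z \<in> span P" for z w
    using that(1)
  proof (induction rule: span_induct)
    case base
    show ?case
      by (auto simp: subspace_def inner_add_right)
  next
    case (step w)
    then show ?case using inner_P[OF that(2)] by simp
  qed
  have norm_W: "norm (fst z) = norm (snd z)" if "z \<in> W" for z
  proof -
    have "closed {z :: 'a \<times> 'a. norm (fst z) = norm (snd z)}"
      by (intro closed_Collect_eq continuous_intros)
    moreover have "span P \<subseteq> {z. norm (fst z) = norm (snd z)}"
      using inner_span by (auto simp: norm_eq_sqrt_inner)
    ultimately show ?thesis
      using that closure_minimal unfolding W_def by blast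
  qed
  have closed_fst: "closed (fst ` W)"
  proof (rule complete_imp_closed)
    show "complete (fst ` W)"
    proof (rule complete_isometric_image)
      show "(0::real) < 1 / 2" by simp
      show "bounded_linear fst" by (rule bounded_linear_fst)
      show "subspace W" by (rule W)
      show "complete W" unfolding W_def by (simp add: complete_eq_closed)
      show "\<forall>z\<in>W. 1 / 2 * norm z \<le> norm (fst z)"
      proof
        fix z assume "z \<in> W"
        then show "1 / 2 * norm z \<le> norm (fst z)"
          using norm_Pair_le[of "fst z" "snd z"] norm_W by simp
      qed
    qed
  qed
  have "subspace (fst ` W)"
    by (rule linear_subspace_image[OF bounded_linear.linear[OF bounded_linear_fst] W])
  moreover have "f ` I \<subseteq> fst ` W"
    using P_W by force
  ultimately have dom: "closure (span (f ` I)) \<subseteq> fst ` W"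
    by (intro closure_minimal closed_fst span_minimal)
  have rng: "snd z \<in> closure (span (f' ` I))" if "z \<in> W" for z
  proof -
    let ?S = "closure (span (f' ` I))"
    have "span P \<subseteq> snd -` ?S"
    proof (rule span_minimal)
      show "P \<subseteq> snd -` ?S"
      proof
        fix z assume "z \<in> P"
        then have "snd z \<in> span (f' ` I)" by (auto simp: P_def intro: span_base)
        then show "z \<in> snd -` ?S" by (intro vimageI2 subsetD[OF closure_subset])
      qed
      have "subspace ?S" by (intro subspace_closure subspace_span)
      then show "subspace (snd -` ?S)" by (auto simp: subspace_def)
    qed
    moreover have "closed (snd -` ?S)"
      by (intro closed_vimage_snd closed_closure)
    ultimately show ?thesis
      using that closure_minimal unfolding W_def by blast
  qed
  have unique: "y = y'" if "(x, y) \<in> W" "(x, y') \<in> W" for x y y'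
    using norm_W[OF subspace_diff[OF W that]] by simp
  define T where "T x = (SOME y. (x, y) \<in> W)" for x
  have T: "(x, T x) \<in> W" if "x \<in> closure (span (f ` I))" for x
  proof -
    from subsetD[OF dom that] obtain z where "z \<in> W" "x = fst z" by blast
    then have "(x, snd z) \<in> W" by simp
    then show ?thesis unfolding T_def by (rule someI)
  qed
  have S: "subspace (closure (span (f ` I)))" by (intro subspace_closure subspace_span)
  show ?thesis
  proof (rule that)
    fix x assume x: "x \<in> closure (span (f ` I))"
    show "T x \<in> closure (span (f' ` I))" using rng[OF T[OF x]] by simp
    show "norm (T x) = norm x" using norm_W[OF T[OF x]] by simp
    show "T (a *\<^sub>R x) = a *\<^sub>R T x" for a
      using unique[OF T[OF subspace_scale[OF S x]]] subspace_scale[OF W T[OF x]] by auto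
    show "T (x + y) = T x + T y" if y: "y \<in> closure (span (f ` I))" for y
      using unique[OF T[OF subspace_add[OF S x y]]] subspace_add[OF W T[OF x] T[OF y]] by auto
  next
    fix i assume "i \<in> I"
    then show "T (f i) = f' i"
      using unique[OF T P_W] subsetD[OF closure_subset span_base[of "f i" "f ` I"]] by blast
  qed
qed

section \<open>Kernels from affine isometric actions\<close>

definition kernel_dist :: "('x \<Rightarrow> 'x \<Rightarrow> real) \<Rightarrow> 'x \<Rightarrow> 'x \<Rightarrow> real" where
  "kernel_dist K x y = K x x + K y y - 2 * K x y"

text \<open>The properties of the kernel \<open>K g h = \<langle>g \<cdot> 0, h \<cdot> 0\<rangle>\<close> of an affine isometric action; the last one
  says that the group moves the orbit of the origin isometrically.\<close>

definition orbit_kernel :: "('a, 'm) monoid_scheme \<Rightarrow> ('a \<Rightarrow> 'a \<Rightarrow> real) \<Rightarrow> bool" where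
  "orbit_kernel G K \<longleftrightarrow>
    positive_semidefinite_on (carrier G) K \<and>
    (\<forall>g\<in>carrier G. K \<one>\<^bsub>G\<^esub> g = 0) \<and>
    (\<forall>x\<in>carrier G. \<forall>g\<in>carrier G. \<forall>h\<in>carrier G.
      kernel_dist K (x \<otimes>\<^bsub>G\<^esub> g) (x \<otimes>\<^bsub>G\<^esub> h) = kernel_dist K g h)"

definition proper_kernel :: "('a, 'm) monoid_scheme \<Rightarrow> ('a \<Rightarrow> 'a \<Rightarrow> real) \<Rightarrow> bool" where
  "proper_kernel G K \<longleftrightarrow> (\<forall>M. finite {g \<in> carrier G. K g g \<le> M})"

context real_inner_space
begin

lemma inner_uminus_left:
  assumes "x \<in> carrier H" "y \<in> carrier H"
  shows "inner_prod H (\<ominus>\<^bsub>H\<^esub> x) y = - inner_prod H x y"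
proof -
  have "inner_prod H (\<zero>\<^bsub>H\<^esub> \<oplus>\<^bsub>H\<^esub> \<zero>\<^bsub>H\<^esub>) y = 2 * inner_prod H \<zero>\<^bsub>H\<^esub> y"
    using assms by (subst inner_add_left) simp_all
  then have "inner_prod H \<zero>\<^bsub>H\<^esub> y = 0" by simp
  moreover have "inner_prod H (\<ominus>\<^bsub>H\<^esub> x \<oplus>\<^bsub>H\<^esub> x) y = inner_prod H (\<ominus>\<^bsub>H\<^esub> x) y + inner_prod H x y"
    using assms by (subst inner_add_left) simp_all
  ultimately show ?thesis using assms by (simp add: M.l_neg)
qed

lemma inner_zero_left: "y \<in> carrier H \<Longrightarrow> inner_prod H \<zero>\<^bsub>H\<^esub> y = 0"
  using inner_smult_left[of "\<zero>\<^bsub>H\<^esub>" y 0] smult_l_null[of "\<zero>\<^bsub>H\<^esub>"] by simp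

lemma ip_dist_square:
  assumes x: "x \<in> carrier H" and y: "y \<in> carrier H"
  shows "(ip_dist H x y)\<^sup>2 = inner_prod H x x + inner_prod H y y - 2 * inner_prod H x y"
proof -
  have xy: "x \<ominus>\<^bsub>H\<^esub> y \<in> carrier H" and my: "\<ominus>\<^bsub>H\<^esub> y \<in> carrier H" using x y by simp_all
  have left: "inner_prod H (x \<ominus>\<^bsub>H\<^esub> y) z = inner_prod H x z - inner_prod H y z" if "z \<in> carrier H" for z
    using x y that by (simp add: M.minus_eq inner_add_left inner_uminus_left)
  have "inner_prod H (x \<ominus>\<^bsub>H\<^esub> y) (x \<ominus>\<^bsub>H\<^esub> y) =
      inner_prod H x (x \<ominus>\<^bsub>H\<^esub> y) - inner_prod H y (x \<ominus>\<^bsub>H\<^esub> y)"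
    by (rule left[OF xy])
  also have "\<dots> = inner_prod H (x \<ominus>\<^bsub>H\<^esub> y) x - inner_prod H (x \<ominus>\<^bsub>H\<^esub> y) y"
    using inner_commute[OF x xy] inner_commute[OF y xy] by simp
  also have "\<dots> = inner_prod H x x + inner_prod H y y - 2 * inner_prod H x y"
    using left[OF x] left[OF y] inner_commute[OF x y] by simp
  finally show ?thesis
    using x y inner_nonneg[OF xy] by (simp add: ip_dist_def ip_norm_def)
qed

text \<open>A linear combination is built up summand by summand inside the module and is then known through its
  inner products, which are ordinary finite sums of reals.\<close>

lemma linear_combination_inner:
  assumes "finite F" "\<And>i. i \<in> F \<Longrightarrow> x i \<in> carrier H"
  shows "\<exists>y\<in>carrier H. \<forall>z\<in>carrier H. inner_prod H y z = (\<Sum>i\<in>F. c i * inner_prod H (x i) z)"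
  using assms
proof (induction F rule: finite_induct)
  case empty
  then show ?case by (intro bexI[of _ "\<zero>\<^bsub>H\<^esub>"]) (auto simp: inner_zero_left)
next
  case (insert i F)
  then obtain y where y: "y \<in> carrier H"
    "\<forall>z\<in>carrier H. inner_prod H y z = (\<Sum>i\<in>F. c i * inner_prod H (x i) z)" by auto
  have "c i \<odot>\<^bsub>H\<^esub> x i \<in> carrier H" using insert.prems smult_closed[of "c i" "x i"] by simp
  then show ?case
    using y insert by (intro bexI[of _ "c i \<odot>\<^bsub>H\<^esub> x i \<oplus>\<^bsub>H\<^esub> y"]) (auto simp: inner_add_left inner_smult_left)
qed

lemma positive_semidefinite_on_inner_prod:
  assumes x: "\<And>i. i \<in> I \<Longrightarrow> x i \<in> carrier H"
  shows "positive_semidefinite_on I (\<lambda>i j. inner_prod H (x i) (x j))"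
  unfolding positive_semidefinite_on_def
proof (intro conjI ballI allI impI)
  show "inner_prod H (x i) (x j) = inner_prod H (x j) (x i)" if "i \<in> I" "j \<in> I" for i j
    using that x by (simp add: inner_commute)
next
  fix F and c :: "_ \<Rightarrow> real" assume F: "finite F" "F \<subseteq> I"
  then have xF: "i \<in> F \<Longrightarrow> x i \<in> carrier H" for i using x by auto
  then obtain y where y: "y \<in> carrier H"
    "\<And>z. z \<in> carrier H \<Longrightarrow> inner_prod H y z = (\<Sum>i\<in>F. c i * inner_prod H (x i) z)"
    using linear_combination_inner[OF F(1), of x c] by auto
  have "inner_prod H y y = (\<Sum>i\<in>F. c i * inner_prod H y (x i))"
    using y(2)[OF y(1)] inner_commute[OF y(1) xF] by (simp cong: sum.cong)
  also have "\<dots> = (\<Sum>i\<in>F. \<Sum>j\<in>F. c i * c j * inner_prod H (x i) (x j))"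
    using y(2)[OF xF] inner_commute[OF xF xF] by (simp add: sum_distrib_left mult.assoc cong: sum.cong)
  finally show "0 \<le> (\<Sum>i\<in>F. \<Sum>j\<in>F. c i * c j * inner_prod H (x i) (x j))"
    using inner_nonneg[OF y(1)] by simp
qed

end

theorem haagerup_imp_proper_orbit_kernel:
  assumes "haagerup TYPE('h) G (discrete_topology (carrier G))"
  obtains K where "orbit_kernel G K" "proper_kernel G K"
proof -
  obtain H :: "'h inner_module" and \<alpha> where
    "lcsc_group G (discrete_topology (carrier G))"
    and H: "real_hilbert_space H"
    and \<alpha>: "affine_isometric_action G (discrete_topology (carrier G)) H \<alpha>"
    and proper: "proper_orbit_map G (discrete_topology (carrier G)) H \<alpha>"
    using assms unfolding haagerup_def by blast
  interpret G: group G
    using \<open>lcsc_group G _\<close> by (simp add: lcsc_group_def)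
  interpret H: real_hilbert_space H by (rule H)
  interpret A: group_action G "carrier H" \<alpha>
    using \<alpha> by (simp add: affine_isometric_action_def)
  define x where "x g = \<alpha> g \<zero>\<^bsub>H\<^esub>" for g
  define K where "K g h = inner_prod H (x g) (x h)" for g h
  have x: "x g \<in> carrier H" if "g \<in> carrier G" for g
    unfolding x_def by (rule A.element_image[OF that H.M.zero_closed HOL.refl])
  have x_one: "x \<one>\<^bsub>G\<^esub> = \<zero>\<^bsub>H\<^esub>"
    unfolding x_def by (metis A.id_eq_one H.M.zero_closed restrict_apply')
  have dist: "kernel_dist K g h = (ip_dist H (x g) (x h))\<^sup>2"
    if "g \<in> carrier G" "h \<in> carrier G" for g h
    using H.ip_dist_square[OF x x] that by (simp add: kernel_dist_def K_def)
  have "kernel_dist K (y \<otimes>\<^bsub>G\<^esub> g) (y \<otimes>\<^bsub>G\<^esub> h) = kernel_dist K g h"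
    if y: "y \<in> carrier G" and g: "g \<in> carrier G" and h: "h \<in> carrier G" for y g h
  proof -
    have "x (y \<otimes>\<^bsub>G\<^esub> g) = \<alpha> y (x g)" "x (y \<otimes>\<^bsub>G\<^esub> h) = \<alpha> y (x h)"
      using A.composition_rule[OF H.M.zero_closed] y g h by (simp_all add: x_def)
    moreover have "ip_dist H (\<alpha> y (x g)) (\<alpha> y (x h)) = ip_dist H (x g) (x h)"
      using \<alpha> y x[OF g] x[OF h] by (simp add: affine_isometric_action_def)
    ultimately show ?thesis using y g h by (simp add: dist)
  qed
  moreover have "positive_semidefinite_on (carrier G) K"
    unfolding K_def by (rule H.positive_semidefinite_on_inner_prod) (rule x)
  moreover have "K \<one>\<^bsub>G\<^esub> g = 0" if "g \<in> carrier G" for g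
    using x[OF that] by (simp add: K_def x_one H.inner_zero_left)
  ultimately have "orbit_kernel G K" by (simp add: orbit_kernel_def)
  moreover have "proper_kernel G K"
    unfolding proper_kernel_def
  proof
    fix M
    \<comment> \<open>a bound beyond \<open>sqrt M\<close>, so that outside \<open>C\<close> the kernel exceeds \<open>M\<close> strictly\<close>
    obtain C where C: "compactin (discrete_topology (carrier G)) C"
      "\<forall>g\<in>carrier G - C. sqrt (\<bar>M\<bar> + 1) \<le> ip_norm H (\<alpha> g \<zero>\<^bsub>H\<^esub>)"
      using proper unfolding proper_orbit_map_def by (metis abs_ge_zero add_nonneg_nonneg real_sqrt_ge_zero zero_le_one)
    have "{g \<in> carrier G. K g g \<le> M} \<subseteq> C"
    proof
      fix g assume g: "g \<in> {g \<in> carrier G. K g g \<le> M}"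
      show "g \<in> C"
      proof (rule ccontr)
        assume "g \<notin> C"
        then have "sqrt (\<bar>M\<bar> + 1) \<le> sqrt (K g g)"
          using C(2) g by (simp add: ip_norm_def K_def x_def)
        then show False using g abs_ge_self[of M] by simp
      qed
    qed
    then show "finite {g \<in> carrier G. K g g \<le> M}"
      using C(1) finite_subset by (auto simp: compactin_discrete_topology)
  qed
  ultimately show ?thesis by (rule that)
qed

section \<open>Affine isometric actions from kernels\<close>

lemma coord_add: "coord (x + y) = (\<lambda>n. coord x n + coord y n)"
  by (rule plus_ell2.rep_eq)

lemma coord_scaleR: "coord (a *\<^sub>R x) = (\<lambda>n. a * coord x n)"
  by (rule scaleR_ell2.rep_eq)

definition coord_space :: "ell2 set \<Rightarrow> (nat \<Rightarrow> real) inner_module" where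
  "coord_space S =
    \<lparr>carrier = coord ` S, monoid.mult = undefined, one = undefined, zero = coord 0,
     add = (\<lambda>x y n. x n + y n), smult = (\<lambda>a x n. a * x n), inner_prod = (\<lambda>x y. \<Sum>n. x n * y n)\<rparr>"

lemma coord_space_simps [simp]:
  "carrier (coord_space S) = coord ` S"
  "\<zero>\<^bsub>coord_space S\<^esub> = coord 0"
  "coord x \<oplus>\<^bsub>coord_space S\<^esub> coord y = coord (x + y)"
  "a \<odot>\<^bsub>coord_space S\<^esub> coord x = coord (a *\<^sub>R x)"
  "inner_prod (coord_space S) (coord x) (coord y) = inner x y"
  by (simp_all add: coord_space_def coord_add coord_scaleR inner_ell2.rep_eq)

lemma real_inner_space_coord_space:
  assumes S: "subspace S"
  shows "real_inner_space (coord_space S)"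
proof -
  note [simp] = subspace_add[OF S] subspace_scale[OF S] subspace_0[OF S]
  have field: "cring real_field"
  proof (rule cringI)
    show "abelian_group real_field"
      by (rule abelian_groupI) (auto intro: exI[of _ "- _"])
    show "comm_monoid real_field"
      by (rule comm_monoidI) auto
  qed (auto simp: algebra_simps)
  have grp: "abelian_group (coord_space S)"
  proof (rule abelian_groupI)
    fix x assume "x \<in> carrier (coord_space S)"
    then obtain u where "u \<in> S" "x = coord u" by auto
    then show "\<exists>y\<in>carrier (coord_space S). y \<oplus>\<^bsub>coord_space S\<^esub> x = \<zero>\<^bsub>coord_space S\<^esub>"
      using subspace_neg[OF S] by (intro bexI[of _ "coord (- u)"]) auto
  qed (auto simp: ac_simps)
  have mod: "Module.module real_field (coord_space S)"
    by (rule Module.moduleI[OF field grp]) (auto simp: scaleR_left_distrib scaleR_right_distrib)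
  show ?thesis
    by (intro real_inner_space.intro real_inner_space_axioms.intro mod)
      (auto simp: inner_add_left intro: inner_commute)
qed

lemma ip_dist_coord_space:
  assumes S: "subspace S" and x: "x \<in> S" and y: "y \<in> S"
  shows "ip_dist (coord_space S) (coord x) (coord y) = dist x y"
proof -
  interpret real_inner_space "coord_space S" by (rule real_inner_space_coord_space[OF S])
  have "(ip_dist (coord_space S) (coord x) (coord y))\<^sup>2 = (dist x y)\<^sup>2"
    using x y
    by (simp add: ip_dist_square dist_norm power2_norm_eq_inner inner_diff_left inner_diff_right
        Inner_Product.inner_commute[of y x])
  moreover have "0 \<le> ip_dist (coord_space S) (coord x) (coord y)"
    using Metric_space_ip_dist by (rule Metric_space.nonneg)
  ultimately show ?thesis by simp
qed

lemma ip_norm_coord_space: "ip_norm (coord_space S) (coord x) = norm x"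
  by (simp add: ip_norm_def norm_eq_sqrt_inner)

lemma real_hilbert_space_coord_space:
  assumes S: "subspace S" and closed: "closed S"
  shows "real_hilbert_space (coord_space S)"
proof -
  interpret real_inner_space "coord_space S" by (rule real_inner_space_coord_space[OF S])
  interpret M: Metric_space "carrier (coord_space S)" "ip_dist (coord_space S)"
    by (rule Metric_space_ip_dist)
  have "M.mcomplete"
    unfolding M.mcomplete_def
  proof (intro allI impI)
    fix \<sigma> assume \<sigma>: "M.MCauchy \<sigma>"
    then have "range \<sigma> \<subseteq> coord ` S"
      unfolding M.MCauchy_def by simp
    then have "\<forall>n. \<exists>u. u \<in> S \<and> \<sigma> n = coord u" by blast
    then obtain u where u: "\<And>n. u n \<in> S" "\<And>n. \<sigma> n = coord (u n)" by metis
    have "Cauchy u"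
      using \<sigma> unfolding M.MCauchy_def Cauchy_def by (simp add: u ip_dist_coord_space[OF S])
    then obtain l where l: "u \<longlonglongrightarrow> l" by (auto simp: Cauchy_convergent_iff convergent_def)
    then have "l \<in> S" using closed u(1) by (metis closed_sequentially)
    then have "limitin M.mtopology \<sigma> (coord l) sequentially"
      using l unfolding M.limit_metric_sequentially LIMSEQ_def
      by (simp add: u ip_dist_coord_space[OF S])
    then show "\<exists>x. limitin M.mtopology \<sigma> x sequentially" by blast
  qed
  then show ?thesis
    by (intro real_hilbert_space.intro real_inner_space_axioms real_hilbert_space_axioms.intro)
qed

lemma lcsc_group_discrete:
  assumes "group G" "countable (carrier G)"
  shows "lcsc_group G (discrete_topology (carrier G))"
proof -
  interpret group G by (rule assms)
  show ?thesis
    by unfold_locales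
      (auto simp: prod_topology_discrete_topology[symmetric] assms
        second_countable_discrete_topology locally_compact_space_discrete_topology)
qed

text \<open>Realise the kernel as a Gram kernel of vectors \<open>b g\<close> and let \<open>S\<close> be their closed span. The
  invariance of distances says that \<open>b h \<mapsto> b (g h) - b g\<close> preserves inner products, so it
  extends to a linear isometry of \<open>S\<close>; adding \<open>b g\<close> gives the affine map \<open>A g\<close> with
  \<open>A g (b h) = b (g h)\<close>. The laws of an action follow, because a point of \<open>S\<close> is determined by its
  distances to the points \<open>b h\<close>, which are permuted by left multiplication.\<close>

theorem affine_isometries_of_orbit_kernel:
  assumes "group G" and cnt: "countable (carrier G)" and K: "orbit_kernel G K"
  obtains S :: "ell2 set" and A b where
    "subspace S" "closed S"
    "\<And>g x. g \<in> carrier G \<Longrightarrow> x \<in> S \<Longrightarrow> A g x \<in> S"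
    "\<And>g x y t. g \<in> carrier G \<Longrightarrow> x \<in> S \<Longrightarrow> y \<in> S \<Longrightarrow>
      A g ((1 - t) *\<^sub>R x + t *\<^sub>R y) = (1 - t) *\<^sub>R A g x + t *\<^sub>R A g y"
    "\<And>g x y. g \<in> carrier G \<Longrightarrow> x \<in> S \<Longrightarrow> y \<in> S \<Longrightarrow> dist (A g x) (A g y) = dist x y"
    "\<And>g h x. g \<in> carrier G \<Longrightarrow> h \<in> carrier G \<Longrightarrow> x \<in> S \<Longrightarrow> A (g \<otimes>\<^bsub>G\<^esub> h) x = A g (A h x)"
    "\<And>x. x \<in> S \<Longrightarrow> A \<one>\<^bsub>G\<^esub> x = x"
    "\<And>g. g \<in> carrier G \<Longrightarrow> (norm (A g 0))\<^sup>2 = K g g"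
proof -
  interpret group G by fact
  have psd: "positive_semidefinite_on (carrier G) K"
    and K_one: "\<And>g. g \<in> carrier G \<Longrightarrow> K \<one>\<^bsub>G\<^esub> g = 0"
    and K_dist: "\<And>x g h. x \<in> carrier G \<Longrightarrow> g \<in> carrier G \<Longrightarrow> h \<in> carrier G \<Longrightarrow>
      kernel_dist K (x \<otimes>\<^bsub>G\<^esub> g) (x \<otimes>\<^bsub>G\<^esub> h) = kernel_dist K g h"
    using K by (auto simp: orbit_kernel_def)
  obtain b :: "'a \<Rightarrow> ell2" where
    b: "\<And>g h. g \<in> carrier G \<Longrightarrow> h \<in> carrier G \<Longrightarrow> inner (b g) (b h) = K g h"
    using positive_semidefinite_on_imp_ell2_embedding[OF cnt psd] by blast
  define S where "S = closure (span (b ` carrier G))"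
  have S: "subspace S" "closed S"
    unfolding S_def by (auto intro: subspace_closure)
  have b_S: "b g \<in> S" if "g \<in> carrier G" for g
    unfolding S_def using subsetD[OF closure_subset span_base[of "b g" "b ` carrier G"]] that by blast
  have b_one: "b \<one>\<^bsub>G\<^esub> = 0"
    using b[of "\<one>\<^bsub>G\<^esub>" "\<one>\<^bsub>G\<^esub>"] K_one[of "\<one>\<^bsub>G\<^esub>"] by simp
  define is_linear_part where "is_linear_part g T \<longleftrightarrow> (\<forall>x\<in>S. T x \<in> S) \<and> (\<forall>x\<in>S. \<forall>y\<in>S. T (x + y) = T x + T y) \<and>
      (\<forall>a. \<forall>x\<in>S. T (a *\<^sub>R x) = a *\<^sub>R T x) \<and> (\<forall>x\<in>S. norm (T x) = norm x) \<and>
      (\<forall>h\<in>carrier G. T (b h) = b (g \<otimes>\<^bsub>G\<^esub> h) - b g)" for g and T :: "ell2 \<Rightarrow> ell2"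
  have ex: "\<exists>T. is_linear_part g T"
    if g: "g \<in> carrier G" for g
  proof -
    let ?f = "\<lambda>h. b (g \<otimes>\<^bsub>G\<^esub> h) - b g"
    have norm_eq: "K (g \<otimes>\<^bsub>G\<^esub> h) (g \<otimes>\<^bsub>G\<^esub> h) + K g g - 2 * K (g \<otimes>\<^bsub>G\<^esub> h) g = K h h"
      if h: "h \<in> carrier G" for h
      using K_dist[OF g h one_closed] K_one[OF h] K_one[OF one_closed]
        positive_semidefinite_on_commute[OF psd one_closed h] g h
      by (simp add: kernel_dist_def)
    have gram: "inner (?f h) (?f k) = inner (b h) (b k)"
      if h: "h \<in> carrier G" and k: "k \<in> carrier G" for h k
    proof -
      have "inner (?f h) (?f k) =
          K (g \<otimes>\<^bsub>G\<^esub> h) (g \<otimes>\<^bsub>G\<^esub> k) - K (g \<otimes>\<^bsub>G\<^esub> h) g - K (g \<otimes>\<^bsub>G\<^esub> k) g + K g g"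
        using g h k positive_semidefinite_on_commute[OF psd g m_closed[OF g k]]
        by (simp add: inner_diff_left inner_diff_right b)
      also have "\<dots> = K h k"
        using K_dist[OF g h k] norm_eq[OF h] norm_eq[OF k] unfolding kernel_dist_def by linarith
      finally show ?thesis using h k by (simp add: b)
    qed
    have "span (?f ` carrier G) \<subseteq> S"
      using b_S g by (intro span_minimal S) (auto intro!: subspace_diff[OF S(1)])
    then have f_S: "closure (span (?f ` carrier G)) \<subseteq> S"
      by (rule closure_minimal) (rule S)
    show ?thesis
    proof (rule linear_isometry_of_equal_gram_matrices[of "carrier G" ?f b, OF gram])
      fix T
      assume T: "\<And>x. x \<in> closure (span (b ` carrier G)) \<Longrightarrow> T x \<in> closure (span (?f ` carrier G))"
        "\<And>x y. x \<in> closure (span (b ` carrier G)) \<Longrightarrow> y \<in> closure (span (b ` carrier G)) \<Longrightarrow>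
          T (x + y) = T x + T y"
        "\<And>a x. x \<in> closure (span (b ` carrier G)) \<Longrightarrow> T (a *\<^sub>R x) = a *\<^sub>R T x"
        "\<And>x. x \<in> closure (span (b ` carrier G)) \<Longrightarrow> norm (T x) = norm x"
        "\<And>h. h \<in> carrier G \<Longrightarrow> T (b h) = ?f h"
      show ?thesis
        unfolding is_linear_part_def by (intro exI[of _ T] conjI ballI allI)
          (use T subsetD[OF f_S] in \<open>simp_all add: S_def\<close>)
    qed
  qed
  define T where "T g = (SOME T. is_linear_part g T)" for g
  have isometry: "is_linear_part g (T g)" if "g \<in> carrier G" for g
    unfolding T_def using ex[OF that] by (rule someI_ex)
  have T: "\<And>g x. g \<in> carrier G \<Longrightarrow> x \<in> S \<Longrightarrow> T g x \<in> S"
    and T_add: "\<And>g x y. g \<in> carrier G \<Longrightarrow> x \<in> S \<Longrightarrow> y \<in> S \<Longrightarrow> T g (x + y) = T g x + T g y"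
    and T_scale: "\<And>g a x. g \<in> carrier G \<Longrightarrow> x \<in> S \<Longrightarrow> T g (a *\<^sub>R x) = a *\<^sub>R T g x"
    and T_norm: "\<And>g x. g \<in> carrier G \<Longrightarrow> x \<in> S \<Longrightarrow> norm (T g x) = norm x"
    and T_b: "\<And>g h. g \<in> carrier G \<Longrightarrow> h \<in> carrier G \<Longrightarrow> T g (b h) = b (g \<otimes>\<^bsub>G\<^esub> h) - b g"
    using isometry unfolding is_linear_part_def by blast+
  define A where "A g x = T g x + b g" for g x
  have A_S: "A g x \<in> S" if "g \<in> carrier G" "x \<in> S" for g x
    unfolding A_def by (intro subspace_add[OF S(1)] T b_S that)
  have A_dist: "dist (A g x) (A g y) = dist x y" if "g \<in> carrier G" "x \<in> S" "y \<in> S" for g x y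
  proof -
    have "T g (x + (- 1) *\<^sub>R y) = T g x + (- 1) *\<^sub>R T g y"
      using that S by (simp only: T_add T_scale subspace_scale)
    then have "T g (x - y) = T g x - T g y" by simp
    then show ?thesis
      using T_norm[OF that(1) subspace_diff[OF S(1) that(2,3)]] by (simp add: dist_norm A_def)
  qed
  have A_b: "A g (b h) = b (g \<otimes>\<^bsub>G\<^esub> h)" if "g \<in> carrier G" "h \<in> carrier G" for g h
    using that by (simp add: A_def T_b)
  \<comment> \<open>The distances to \<open>b \<one> = 0\<close> and to \<open>b h\<close> determine the inner product with \<open>b h\<close>.\<close>
  have determined: "x = y"
    if x: "x \<in> S" and y: "y \<in> S" and d: "\<And>h. h \<in> carrier G \<Longrightarrow> dist x (b h) = dist y (b h)" for x y
  proof -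
    have "norm x = norm y" using d[OF one_closed] by (simp add: b_one)
    then have "inner (x - y) (b h) = 0" if "h \<in> carrier G" for h
      using d[OF that] unfolding dist_norm
      by (simp add: norm_eq inner_diff_left inner_diff_right inner_commute)
    then have "b ` carrier G \<subseteq> {z. inner (x - y) z = 0}" by auto
    moreover have "subspace {z. inner (x - y) z = 0}"
      by (auto simp: subspace_def inner_add_right)
    moreover have "closed {z. inner (x - y) z = 0}"
      by (intro closed_Collect_eq continuous_intros)
    ultimately have "S \<subseteq> {z. inner (x - y) z = 0}"
      unfolding S_def by (intro closure_minimal span_minimal)
    then have "inner (x - y) (x - y) = 0" using subspace_diff[OF S(1) x y] by blast
    then show ?thesis by simp
  qed
  have A_mult: "A (g \<otimes>\<^bsub>G\<^esub> h) x = A g (A h x)"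
    if g: "g \<in> carrier G" and h: "h \<in> carrier G" and x: "x \<in> S" for g h x
  proof (rule determined)
    fix k assume k: "k \<in> carrier G"
    define k' where "k' = inv\<^bsub>G\<^esub> (g \<otimes>\<^bsub>G\<^esub> h) \<otimes>\<^bsub>G\<^esub> k"
    have k': "k' \<in> carrier G" "k = g \<otimes>\<^bsub>G\<^esub> h \<otimes>\<^bsub>G\<^esub> k'"
      using g h k by (auto simp: k'_def m_assoc[symmetric])
    have "dist (A (g \<otimes>\<^bsub>G\<^esub> h) x) (b k) = dist x (b k')"
      using A_dist[OF _ x b_S, of "g \<otimes>\<^bsub>G\<^esub> h" k'] A_b[of "g \<otimes>\<^bsub>G\<^esub> h" k'] g h k' by simp
    also have "\<dots> = dist (A g (A h x)) (A g (A h (b k')))"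
      using A_dist A_S b_S g h x k'(1) by simp
    also have "A g (A h (b k')) = b k"
      using g h k' by (simp add: A_b m_assoc)
    finally show "dist (A (g \<otimes>\<^bsub>G\<^esub> h) x) (b k) = dist (A g (A h x)) (b k)" .
  qed (use A_S g h x in auto)
  have A_one: "A \<one>\<^bsub>G\<^esub> x = x" if x: "x \<in> S" for x
  proof (rule determined)
    fix k assume k: "k \<in> carrier G"
    then show "dist (A \<one>\<^bsub>G\<^esub> x) (b k) = dist x (b k)"
      using A_dist[OF one_closed x b_S[OF k]] A_b[OF one_closed k] by simp
  qed (use A_S x in auto)
  show ?thesis
  proof (rule that[of S A, OF S A_S _ A_dist A_mult A_one])
    fix g assume g: "g \<in> carrier G"
    show "(norm (A g 0))\<^sup>2 = K g g"
      using A_b[OF g one_closed] g by (simp add: b_one power2_norm_eq_inner b)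
    show "A g ((1 - t) *\<^sub>R x + t *\<^sub>R y) = (1 - t) *\<^sub>R A g x + t *\<^sub>R A g y"
      if "x \<in> S" "y \<in> S" for x y t
    proof -
      have "T g ((1 - t) *\<^sub>R x + t *\<^sub>R y) = (1 - t) *\<^sub>R T g x + t *\<^sub>R T g y"
        using that g S(1) by (simp only: T_add T_scale subspace_scale)
      then show ?thesis by (simp add: A_def algebra_simps)
    qed
  qed
qed

theorem proper_orbit_kernel_imp_haagerup:
  assumes "group G" and cnt: "countable (carrier G)"
    and K: "orbit_kernel G K" and proper: "proper_kernel G K"
  shows "haagerup TYPE(nat \<Rightarrow> real) G (discrete_topology (carrier G))"
proof -
  interpret group G by fact
  obtain S :: "ell2 set" and A where S: "subspace S" "closed S"
    and A: "\<And>g x. g \<in> carrier G \<Longrightarrow> x \<in> S \<Longrightarrow> A g x \<in> S"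
    and A_affine: "\<And>g x y t. g \<in> carrier G \<Longrightarrow> x \<in> S \<Longrightarrow> y \<in> S \<Longrightarrow>
      A g ((1 - t) *\<^sub>R x + t *\<^sub>R y) = (1 - t) *\<^sub>R A g x + t *\<^sub>R A g y"
    and A_dist: "\<And>g x y. g \<in> carrier G \<Longrightarrow> x \<in> S \<Longrightarrow> y \<in> S \<Longrightarrow> dist (A g x) (A g y) = dist x y"
    and A_mult: "\<And>g h x. g \<in> carrier G \<Longrightarrow> h \<in> carrier G \<Longrightarrow> x \<in> S \<Longrightarrow> A (g \<otimes>\<^bsub>G\<^esub> h) x = A g (A h x)"
    and A_one: "\<And>x. x \<in> S \<Longrightarrow> A \<one>\<^bsub>G\<^esub> x = x"
    and A_norm: "\<And>g. g \<in> carrier G \<Longrightarrow> (norm (A g 0))\<^sup>2 = K g g"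
    by (rule affine_isometries_of_orbit_kernel[OF \<open>group G\<close> cnt K]) (rule that)
  let ?E = "coord ` S"
  define \<alpha> where "\<alpha> g = (\<lambda>x\<in>?E. coord (A g (Abs_ell2 x)))" for g
  have \<alpha>: "\<alpha> g (coord x) = coord (A g x)" if "x \<in> S" for g x
    using that by (simp add: \<alpha>_def coord_inverse)
  have zero: "0 \<in> S" by (rule subspace_0[OF S(1)])
  have bij: "bij_betw (\<alpha> g) ?E ?E" if g: "g \<in> carrier G" for g
  proof (rule bij_betw_byWitness[where f' = "\<alpha> (inv\<^bsub>G\<^esub> g)"])
    show "\<forall>x\<in>?E. \<alpha> (inv\<^bsub>G\<^esub> g) (\<alpha> g x) = x" "\<forall>x\<in>?E. \<alpha> g (\<alpha> (inv\<^bsub>G\<^esub> g) x) = x"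
      using g A_mult[of "inv\<^bsub>G\<^esub> g" g] A_mult[of g "inv\<^bsub>G\<^esub> g"] A_one by (auto simp: \<alpha> A)
    show "\<alpha> g ` ?E \<subseteq> ?E" "\<alpha> (inv\<^bsub>G\<^esub> g) ` ?E \<subseteq> ?E"
      using g by (auto simp: \<alpha> A)
  qed
  have Bij: "\<alpha> g \<in> Bij ?E" if "g \<in> carrier G" for g
    using bij[OF that] by (simp add: Bij_def \<alpha>_def)
  have "group_action G ?E \<alpha>"
    unfolding group_action_def
  proof (intro group_hom.intro group_hom_axioms.intro \<open>group G\<close> group_BijGroup homI)
    fix g h assume g: "g \<in> carrier G" and h: "h \<in> carrier G"
    have "\<alpha> (g \<otimes>\<^bsub>G\<^esub> h) = compose ?E (\<alpha> g) (\<alpha> h)"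
      by (rule extensionalityI[of _ ?E]) (use g h in \<open>auto simp: compose_def \<alpha>_def coord_inverse A A_mult\<close>)
    then show "\<alpha> (g \<otimes>\<^bsub>G\<^esub> h) = \<alpha> g \<otimes>\<^bsub>BijGroup ?E\<^esub> \<alpha> h"
      using g h by (simp add: BijGroup_def Bij)
  qed (simp add: BijGroup_def Bij)
  moreover have "continuous_map (discrete_topology (carrier G))
      (Metric_space.mtopology ?E (ip_dist (coord_space S))) (\<lambda>g. \<alpha> g x)" if "x \<in> ?E" for x
  proof -
    interpret H: real_inner_space "coord_space S" by (rule real_inner_space_coord_space[OF S(1)])
    have "topspace (Metric_space.mtopology ?E (ip_dist (coord_space S))) = ?E"
      using Metric_space.topspace_mtopology[OF H.Metric_space_ip_dist] by simp
    then show ?thesis using that by (auto simp: \<alpha> A)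
  qed
  ultimately have "affine_isometric_action G (discrete_topology (carrier G)) (coord_space S) \<alpha>"
    unfolding affine_isometric_action_def
    using S by (auto simp: \<alpha> A A_affine A_dist ip_dist_coord_space subspace_add subspace_scale)
  moreover have "proper_orbit_map G (discrete_topology (carrier G)) (coord_space S) \<alpha>"
    unfolding proper_orbit_map_def
  proof (intro allI impI)
    fix M :: real assume M: "0 \<le> M"
    let ?C = "{g \<in> carrier G. K g g \<le> M\<^sup>2}"
    have "M \<le> ip_norm (coord_space S) (\<alpha> g \<zero>\<^bsub>coord_space S\<^esub>)" if g: "g \<in> carrier G - ?C" for g
    proof -
      have "M\<^sup>2 \<le> (norm (A g 0))\<^sup>2" using g A_norm by auto
      then have "M \<le> norm (A g 0)" by (rule power2_le_imp_le) simp
      then show ?thesis using zero by (simp add: \<alpha> ip_norm_coord_space)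
    qed
    moreover have "compactin (discrete_topology (carrier G)) ?C"
      using proper by (auto simp: compactin_discrete_topology proper_kernel_def)
    ultimately show "\<exists>C. compactin (discrete_topology (carrier G)) C \<and>
        (\<forall>g\<in>carrier G - C. M \<le> ip_norm (coord_space S) (\<alpha> g \<zero>\<^bsub>coord_space S\<^esub>))"
      by blast
  qed
  ultimately show ?thesis
    unfolding haagerup_def
    using lcsc_group_discrete[OF \<open>group G\<close> cnt] real_hilbert_space_coord_space[OF S] by blast
qed

section \<open>Graph products as words up to relations\<close>

locale graph_of_groups =
  fixes V :: "'v set" and E :: "'v set set" and G :: "'v \<Rightarrow> ('a, 'm) monoid_scheme"
  assumes graph: "simplicial_graph V E" and grp: "\<And>v. v \<in> V \<Longrightarrow> group (G v)"
begin

abbreviation W :: "('v \<times> 'a) list set" where "W \<equiv> syllable_words V G"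
abbreviation R :: "(('v \<times> 'a) list \<times> ('v \<times> 'a) list) set" where "R \<equiv> free_product_rel V G"
abbreviation F :: "('v \<times> 'a) list set monoid" where "F \<equiv> free_product V G"
abbreviation N :: "('v \<times> 'a) list set set" where
  "N \<equiv> normal_closure F (graph_product_relators V E G)"
abbreviation \<Gamma> :: "('v \<times> 'a) list set set monoid" where "\<Gamma> \<equiv> graph_product V E G"

definition word_class :: "('v \<times> 'a) list \<Rightarrow> ('v \<times> 'a) list set" where "word_class w = R `` {w}"

definition word_value :: "('v \<times> 'a) list \<Rightarrow> ('v \<times> 'a) list set set" where "word_value w = N #>\<^bsub>F\<^esub> word_class w"

definition inv_word :: "('v \<times> 'a) list \<Rightarrow> ('v \<times> 'a) list" where
  "inv_word w = rev (map (\<lambda>(v, g). (v, inv\<^bsub>G v\<^esub> g)) w)"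

lemma one_closed_vertex [simp]: "v \<in> V \<Longrightarrow> \<one>\<^bsub>G v\<^esub> \<in> carrier (G v)"
  using grp[of v] by (simp add: group.is_monoid monoid.one_closed)

lemma mult_closed_vertex [simp]:
  "v \<in> V \<Longrightarrow> g \<in> carrier (G v) \<Longrightarrow> h \<in> carrier (G v) \<Longrightarrow> g \<otimes>\<^bsub>G v\<^esub> h \<in> carrier (G v)"
  using grp[of v] by (simp add: group.is_monoid monoid.m_closed)

lemma inv_closed_vertex [simp]: "v \<in> V \<Longrightarrow> g \<in> carrier (G v) \<Longrightarrow> inv\<^bsub>G v\<^esub> g \<in> carrier (G v)"
  using grp[of v] by (simp add: group.inv_closed)

lemma adjacent_distinct: "{v, u} \<in> E \<Longrightarrow> v \<noteq> u"
  using graph by (auto simp: simplicial_graph_def)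

lemma words_Nil [simp]: "[] \<in> W"
  and words_Cons [simp]: "(v, g) # w \<in> W \<longleftrightarrow> v \<in> V \<and> g \<in> carrier (G v) \<and> w \<in> W"
  and words_append [simp]: "x @ y \<in> W \<longleftrightarrow> x \<in> W \<and> y \<in> W"
  by (auto simp: syllable_words_def)

lemma words_inv_word [simp]: "w \<in> W \<Longrightarrow> inv_word w \<in> W"
  by (induction w) (auto simp: inv_word_def)

lemma rel_words: "(w, w') \<in> R \<Longrightarrow> w \<in> W \<and> w' \<in> W"
  using free_product_rel_words[of w w' V G] grp by blast

lemma rel_append:
  assumes "(x, x') \<in> R" "(y, y') \<in> R"
  shows "(x @ y, x' @ y') \<in> R"
proof -
  have "(x @ y, x' @ y) \<in> R" "(x' @ y, x' @ y') \<in> R"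
    using free_product_rel_append[OF assms(1), of "[]" y] free_product_rel_append[OF assms(2), of x' "[]"]
      rel_words[OF assms(1)] rel_words[OF assms(2)] by auto
  then show ?thesis by (rule free_product_rel.trans)
qed

sublocale F: group F
  by (rule group_free_product[OF grp])

lemma equiv_R: "equiv W R"
  by (rule equiv_free_product_rel[OF grp])

lemma word_class_eq_iff: "w \<in> W \<Longrightarrow> w' \<in> W \<Longrightarrow> word_class w = word_class w' \<longleftrightarrow> (w, w') \<in> R"
  unfolding word_class_def using eq_equiv_class_iff[OF equiv_R] by simp

lemma carrier_F: "carrier F = word_class ` W"
  by (auto simp: free_product_def quotient_def word_class_def)

lemma word_class_closed [simp]: "w \<in> W \<Longrightarrow> word_class w \<in> carrier F"
  by (simp add: carrier_F)

lemma word_class_mult: "x \<in> W \<Longrightarrow> y \<in> W \<Longrightarrow> word_class x \<otimes>\<^bsub>F\<^esub> word_class y = word_class (x @ y)"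
proof -
  assume "x \<in> W" "y \<in> W"
  have "congruent2 R R (\<lambda>x y. R `` {x @ y})"
    by (intro congruent2I' equiv_class_eq[OF equiv_R] rel_append)
  from UN_equiv_class2[OF equiv_R equiv_R this \<open>x \<in> W\<close> \<open>y \<in> W\<close>] show ?thesis
    by (simp add: free_product_def word_class_def)
qed

lemma word_class_Nil: "\<one>\<^bsub>F\<^esub> = word_class []"
  by (simp add: free_product_def word_class_def)

lemma inv_word_append_rel: "w \<in> W \<Longrightarrow> (inv_word w @ w, []) \<in> R"
proof (induction w)
  case Nil
  then show ?case by (simp add: inv_word_def free_product_rel.refl)
next
  case (Cons s w)
  obtain v g where s: "s = (v, g)" by (cases s)
  then have v: "v \<in> V" and g: "g \<in> carrier (G v)" and w: "w \<in> W" using Cons.prems by auto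
  have w': "inv_word w \<in> W" using w by simp
  have "(inv_word w @ [(v, inv\<^bsub>G v\<^esub> g), (v, g)] @ w, inv_word w @ [(v, \<one>\<^bsub>G v\<^esub>)] @ w) \<in> R"
    using free_product_rel.mult[of v V "inv\<^bsub>G v\<^esub> g" G g "inv_word w" w] v g w w' grp[OF v]
    by (simp add: group.l_inv)
  moreover have "(inv_word w @ [(v, \<one>\<^bsub>G v\<^esub>)] @ w, inv_word w @ w) \<in> R"
    by (rule free_product_rel.one[OF v w' w])
  ultimately have "(inv_word w @ [(v, inv\<^bsub>G v\<^esub> g), (v, g)] @ w, []) \<in> R"
    using Cons.IH[OF w] by (blast intro: free_product_rel.trans)
  then show ?case by (simp add: s inv_word_def)
qed

lemma inv_word_class: "w \<in> W \<Longrightarrow> inv\<^bsub>F\<^esub> (word_class w) = word_class (inv_word w)"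
  using inv_word_append_rel[of w] by (intro F.inv_equality) (simp_all add: word_class_mult word_class_Nil word_class_eq_iff)

lemma relators_closed: "graph_product_relators V E G \<subseteq> carrier F"
proof
  fix X assume "X \<in> graph_product_relators V E G"
  then obtain v u g h where "X = commutator F (word_class [(v, g)]) (word_class [(u, h)])" "v \<in> V" "u \<in> V"
    "g \<in> carrier (G v)" "h \<in> carrier (G u)"
    unfolding graph_product_relators_def free_product_incl_def word_class_def by blast
  then show "X \<in> carrier F" by (simp add: commutator_def)
qed

lemma normal_carrier: "carrier F \<lhd> F"
  by (simp add: F.normal_inv_iff F.subgroup_self)

lemma normal_N: "N \<lhd> F"
  unfolding F.normal_inv_iff
proof (intro conjI ballI)
  show "subgroup N F"
    unfolding normal_closure_def
    using normal_carrier relators_closed by (intro F.subgroups_Inter) (auto simp: normal_def)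
  fix x h assume "x \<in> carrier F" "h \<in> N"
  then show "x \<otimes>\<^bsub>F\<^esub> h \<otimes>\<^bsub>F\<^esub> inv\<^bsub>F\<^esub> x \<in> N"
    by (auto simp: normal_closure_def F.normal_inv_iff)
qed

sublocale N: normal N F
  by (rule normal_N)

sublocale group \<Gamma>
  unfolding graph_product_def by (rule N.factorgroup_is_group)

lemma relators_in_N: "graph_product_relators V E G \<subseteq> N"
  by (auto simp: normal_closure_def)

lemma carrier_\<Gamma>: "carrier \<Gamma> = word_value ` W"
  by (simp add: graph_product_def carrier_FactGroup carrier_F word_value_def image_image)

lemma word_value_closed [simp]: "w \<in> W \<Longrightarrow> word_value w \<in> carrier \<Gamma>"
  by (simp add: carrier_\<Gamma>)

lemma word_value_append: "x \<in> W \<Longrightarrow> y \<in> W \<Longrightarrow> word_value (x @ y) = word_value x \<otimes>\<^bsub>\<Gamma>\<^esub> word_value y"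
  by (simp add: graph_product_def word_value_def N.rcos_sum word_class_mult)

lemma word_value_Nil [simp]: "word_value [] = \<one>\<^bsub>\<Gamma>\<^esub>"
  by (simp add: graph_product_def word_value_def N.subset flip: word_class_Nil)

lemma word_value_Cons: "v \<in> V \<Longrightarrow> g \<in> carrier (G v) \<Longrightarrow> w \<in> W \<Longrightarrow> word_value ((v, g) # w) = word_value [(v, g)] \<otimes>\<^bsub>\<Gamma>\<^esub> word_value w"
  using word_value_append[of "[(v, g)]" w] by simp

lemma word_value_rel: "(w, w') \<in> R \<Longrightarrow> word_value w = word_value w'"
  using rel_words word_class_eq_iff by (metis word_value_def)

lemma word_value_one [simp]: "v \<in> V \<Longrightarrow> word_value [(v, \<one>\<^bsub>G v\<^esub>)] = \<one>\<^bsub>\<Gamma>\<^esub>"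
  using word_value_rel[OF free_product_rel.one[of v V "[]" G "[]"]] by simp

lemma word_value_mult:
  "v \<in> V \<Longrightarrow> g \<in> carrier (G v) \<Longrightarrow> h \<in> carrier (G v) \<Longrightarrow> word_value [(v, g), (v, h)] = word_value [(v, g \<otimes>\<^bsub>G v\<^esub> h)]"
  using word_value_rel[OF free_product_rel.mult[of v V g G h "[]" "[]"]] by simp

lemma word_value_commute:
  assumes v: "v \<in> V" and u: "u \<in> V" and e: "{v, u} \<in> E" and g: "g \<in> carrier (G v)" and h: "h \<in> carrier (G u)"
  shows "word_value [(v, g), (u, h)] = word_value [(u, h), (v, g)]"
proof -
  let ?x = "word_class [(v, g)]" and ?y = "word_class [(u, h)]"
  have x: "?x \<in> carrier F" and y: "?y \<in> carrier F" using assms by simp_all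
  have "commutator F ?x ?y \<in> graph_product_relators V E G"
    unfolding graph_product_relators_def free_product_incl_def word_class_def using assms by blast
  then have c: "commutator F ?x ?y \<in> N" by (rule subsetD[OF relators_in_N])
  then have c': "commutator F ?x ?y \<in> carrier F" by simp
  have "commutator F ?x ?y \<otimes>\<^bsub>F\<^esub> (?y \<otimes>\<^bsub>F\<^esub> ?x) = ?x \<otimes>\<^bsub>F\<^esub> ?y"
    using x y F.m_assoc[of "inv\<^bsub>F\<^esub> ?y" ?y ?x] by (simp add: commutator_def F.m_assoc)
  moreover have "N #>\<^bsub>F\<^esub> (commutator F ?x ?y \<otimes>\<^bsub>F\<^esub> (?y \<otimes>\<^bsub>F\<^esub> ?x)) = N #>\<^bsub>F\<^esub> (?y \<otimes>\<^bsub>F\<^esub> ?x)"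
    using F.coset_mult_assoc[OF N.subset c', of "?y \<otimes>\<^bsub>F\<^esub> ?x"] N.rcos_const[OF F.is_group c] x y by simp
  ultimately show ?thesis using assms by (simp add: word_value_def word_class_mult)
qed

text \<open>The universal property of the graph product in a form that does not ask for a target group: every
  function of words that is unchanged by the three kinds of relations is a function of the group
  element. The words that can be erased everywhere without changing \<open>f\<close> form a normal subgroup of the free
  product. It contains the commutators that are divided out, hence their normal closure.\<close>

theorem word_function_invariant:
  fixes f :: "('v \<times> 'a) list \<Rightarrow> 'c"
  assumes one: "\<And>v xs ys. v \<in> V \<Longrightarrow> xs \<in> W \<Longrightarrow> ys \<in> W \<Longrightarrow> f (xs @ (v, \<one>\<^bsub>G v\<^esub>) # ys) = f (xs @ ys)"
    and mult: "\<And>v g h xs ys. v \<in> V \<Longrightarrow> g \<in> carrier (G v) \<Longrightarrow> h \<in> carrier (G v) \<Longrightarrow> xs \<in> W \<Longrightarrow> ys \<in> W \<Longrightarrow>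
      f (xs @ (v, g) # (v, h) # ys) = f (xs @ (v, g \<otimes>\<^bsub>G v\<^esub> h) # ys)"
    and commute: "\<And>v u g h xs ys. v \<in> V \<Longrightarrow> u \<in> V \<Longrightarrow> {v, u} \<in> E \<Longrightarrow> g \<in> carrier (G v) \<Longrightarrow>
      h \<in> carrier (G u) \<Longrightarrow> xs \<in> W \<Longrightarrow> ys \<in> W \<Longrightarrow>
      f (xs @ (v, g) # (u, h) # ys) = f (xs @ (u, h) # (v, g) # ys)"
    and w: "w \<in> W" and w': "w' \<in> W" and eq: "word_value w = word_value w'"
  shows "f w = f w'"
proof -
  have rel: "f x = f y" if "(x, y) \<in> R" for x y
    using that by induction (simp_all add: one mult)
  define Z where "Z = {z \<in> W. \<forall>a\<in>W. \<forall>b\<in>W. f (a @ z @ b) = f (a @ b)}"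
  have Z: "z \<in> W" and Z_erase: "\<And>a b. a \<in> W \<Longrightarrow> b \<in> W \<Longrightarrow> f (a @ z @ b) = f (a @ b)" if "z \<in> Z" for z
    using that by (auto simp: Z_def)
  have Z_inv: "inv_word z \<in> Z" if z: "z \<in> Z" for z
  proof -
    have "f (a @ inv_word z @ b) = f (a @ b)" if "a \<in> W" "b \<in> W" for a b
    proof -
      have "f (a @ inv_word z @ b) = f (a @ inv_word z @ z @ b)"
        using Z_erase[OF z, of "a @ inv_word z" b] Z[OF z] that by simp
      also have "\<dots> = f (a @ b)"
        using rel[OF free_product_rel_append[OF inv_word_append_rel[OF Z[OF z]] that]] by simp
      finally show ?thesis .
    qed
    then show ?thesis using Z[OF z] by (simp add: Z_def)
  qed
  have "word_class ` Z \<lhd> F"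
    unfolding F.normal_inv_iff
  proof (intro conjI ballI)
    show "subgroup (word_class ` Z) F"
    proof (rule F.subgroupI)
      show "word_class ` Z \<subseteq> carrier F" using Z by auto
      have "[] \<in> Z" by (simp add: Z_def)
      then show "word_class ` Z \<noteq> {}" by blast
      show "inv\<^bsub>F\<^esub> X \<in> word_class ` Z" if "X \<in> word_class ` Z" for X
        using that Z Z_inv by (auto simp: inv_word_class)
      fix X Y assume "X \<in> word_class ` Z" "Y \<in> word_class ` Z"
      then obtain x y where x: "x \<in> Z" "X = word_class x" and y: "y \<in> Z" "Y = word_class y" by blast
      have "x @ y \<in> Z"
        using Z[OF x(1)] Z[OF y(1)] Z_erase[OF x(1), of _ "y @ _"] Z_erase[OF y(1)] by (simp add: Z_def)
      then show "X \<otimes>\<^bsub>F\<^esub> Y \<in> word_class ` Z" using x y Z by (auto simp: word_class_mult)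
    qed
    fix C X assume "C \<in> carrier F" "X \<in> word_class ` Z"
    then obtain c x where c: "c \<in> W" "C = word_class c" and x: "x \<in> Z" "X = word_class x"
      by (auto simp: carrier_F)
    have "c @ x @ inv_word c \<in> Z"
    proof -
      have "f (a @ c @ x @ inv_word c @ b) = f (a @ b)" if a: "a \<in> W" and b: "b \<in> W" for a b
      proof -
        have "f (a @ c @ x @ inv_word c @ b) = f (a @ c @ inv_word c @ b)"
          using Z_erase[OF x(1), of "a @ c" "inv_word c @ b"] a b c by simp
        also have "\<dots> = f (a @ b)"
        proof -
          have "word_class (c @ inv_word c) = word_class []"
            using c F.r_inv[of "word_class c"] by (simp add: inv_word_class word_class_mult word_class_Nil)
          then have "(c @ inv_word c, []) \<in> R" using c by (simp add: word_class_eq_iff)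
          from rel[OF free_product_rel_append[OF this a b]] show ?thesis by simp
        qed
        finally show ?thesis .
      qed
      then show ?thesis using c Z[OF x(1)] by (simp add: Z_def)
    qed
    then show "C \<otimes>\<^bsub>F\<^esub> X \<otimes>\<^bsub>F\<^esub> inv\<^bsub>F\<^esub> C \<in> word_class ` Z"
      using c x Z by (simp add: inv_word_class word_class_mult)
  qed
  moreover have "graph_product_relators V E G \<subseteq> word_class ` Z"
  proof
    fix X assume "X \<in> graph_product_relators V E G"
    then obtain v u g h where X: "X = commutator F (word_class [(v, g)]) (word_class [(u, h)])"
      and v: "v \<in> V" and u: "u \<in> V" and e: "{v, u} \<in> E"
      and g: "g \<in> carrier (G v)" and h: "h \<in> carrier (G u)"
      unfolding graph_product_relators_def free_product_incl_def word_class_def by blast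
    define z where "z = [(v, g), (u, h), (v, inv\<^bsub>G v\<^esub> g), (u, inv\<^bsub>G u\<^esub> h)]"
    have "X = word_class z"
      using v u g h by (simp add: X commutator_def inv_word_class word_class_mult z_def) (simp add: inv_word_def)
    moreover have "f (a @ z @ b) = f (a @ b)" if a: "a \<in> W" and b: "b \<in> W" for a b
    proof -
      have "f (a @ z @ b) = f (a @ (u, h) # (v, g) # (v, inv\<^bsub>G v\<^esub> g) # (u, inv\<^bsub>G u\<^esub> h) # b)"
        using commute[OF v u e g h a] v u g h b by (simp add: z_def)
      also have "\<dots> = f (a @ (u, h) # (u, inv\<^bsub>G u\<^esub> h) # b)"
        using mult[of v g "inv\<^bsub>G v\<^esub> g" "a @ [(u, h)]" "(u, inv\<^bsub>G u\<^esub> h) # b"]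
          one[of v "a @ [(u, h)]" "(u, inv\<^bsub>G u\<^esub> h) # b"] v u g h a b grp[OF v]
        by (simp add: group.r_inv)
      also have "\<dots> = f (a @ b)"
        using mult[of u h "inv\<^bsub>G u\<^esub> h" a b] one[of u a b] u h a b grp[OF u] by (simp add: group.r_inv)
      finally show ?thesis .
    qed
    ultimately show "X \<in> word_class ` Z"
      using v u g h by (auto simp: Z_def z_def intro!: image_eqI)
  qed
  ultimately have "N \<subseteq> word_class ` Z"
    unfolding normal_closure_def by blast
  moreover have "word_class w \<in> N #>\<^bsub>F\<^esub> word_class w'"
    using F.rcos_self[OF _ N.is_subgroup, of "word_class w"] w eq by (simp add: word_value_def)
  ultimately obtain z where z: "z \<in> Z" "word_class w = word_class z \<otimes>\<^bsub>F\<^esub> word_class w'"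
    by (auto simp: r_coset_def)
  then have "(w, z @ w') \<in> R"
    using w w' Z[OF z(1)] by (simp add: word_class_mult word_class_eq_iff)
  then show ?thesis
    using rel[of w "z @ w'"] Z_erase[OF z(1), of "[]" w'] w' by simp
qed

end

section \<open>Minimal words and the walls they cross\<close>

context graph_of_groups
begin

lemma word_value_replace_infix:
  assumes "xs \<in> W" "ys \<in> W" "m \<in> W" "m' \<in> W" "word_value m = word_value m'"
  shows "word_value (xs @ m @ ys) = word_value (xs @ m' @ ys)"
  using assms by (simp add: word_value_append)

lemma word_value_inv_word: "w \<in> W \<Longrightarrow> word_value (inv_word w) = inv\<^bsub>\<Gamma>\<^esub> word_value w"
  using word_value_rel[OF inv_word_append_rel[of w]] by (intro inv_equality[symmetric]) (simp_all add: word_value_append)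

definition star :: "'v \<Rightarrow> 'v set" where "star v = {u. u = v \<or> {v, u} \<in> E}"

definition words_over :: "'v set \<Rightarrow> ('v \<times> 'a) list set" where
  "words_over A = {w \<in> W. fst ` set w \<subseteq> A}"

text \<open>The subgroup generated by the vertex groups of the star. Since a vertex belongs to its star, this is
  \<open>G\<^sub>v\<close> times the subgroup generated by the vertex groups adjacent to \<open>v\<close>.\<close>

definition star_subgroup :: "'v \<Rightarrow> ('v \<times> 'a) list set set set" where
  "star_subgroup v = word_value ` words_over (star v)"

definition minimal_word :: "('v \<times> 'a) list \<Rightarrow> bool" where
  "minimal_word w \<longleftrightarrow> w \<in> W \<and> (\<forall>w'\<in>W. word_value w' = word_value w \<longrightarrow> length w \<le> length w')"

lemma minimal_word_infix:
  assumes "minimal_word (x @ m @ y)"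
  shows "minimal_word m"
  unfolding minimal_word_def
proof (intro conjI ballI impI)
  have W: "x \<in> W" "m \<in> W" "y \<in> W" using assms by (simp_all add: minimal_word_def)
  then show "m \<in> W" by simp
  fix m' assume "m' \<in> W" "word_value m' = word_value m"
  then have "x @ m' @ y \<in> W" "word_value (x @ m' @ y) = word_value (x @ m @ y)"
    using W word_value_replace_infix[of x y m' m] by simp_all
  then have "length (x @ m @ y) \<le> length (x @ m' @ y)"
    using assms unfolding minimal_word_def by blast
  then show "length m \<le> length m'" by simp
qed

lemma ex_minimal_word:
  assumes "g \<in> carrier \<Gamma>"
  shows "\<exists>w. minimal_word w \<and> word_value w = g"
proof -
  obtain w where "w \<in> W \<and> word_value w = g" using assms by (auto simp: carrier_\<Gamma>)
  from ex_has_least_nat[where P = "\<lambda>w. w \<in> W \<and> word_value w = g" and m = length, OF this]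
  show ?thesis unfolding minimal_word_def by metis
qed

lemma minimal_word_syllable_nontrivial:
  assumes "minimal_word w" "(v, s) \<in> set w"
  shows "s \<noteq> \<one>\<^bsub>G v\<^esub>"
proof
  assume "s = \<one>\<^bsub>G v\<^esub>"
  obtain x y where w: "w = x @ [(v, s)] @ y" using assms(2) by (metis split_list append_Cons append_Nil)
  then have "minimal_word [(v, s)]" using assms(1) minimal_word_infix by blast
  then show False using \<open>s = _\<close> unfolding minimal_word_def by (auto dest!: bspec[of _ _ "[]"])
qed

text \<open>Deleting all syllables outside \<open>A\<close> is compatible with the relations: it is the retraction of the
  graph product onto the subgroup generated by the vertex groups in \<open>A\<close>.\<close>

lemma word_value_filter_syllables:
  assumes "w \<in> W" "w' \<in> W" "word_value w = word_value w'"
  shows "word_value (filter (\<lambda>s. fst s \<in> A) w) = word_value (filter (\<lambda>s. fst s \<in> A) w')"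
proof -
  let ?f = "filter (\<lambda>s. fst s \<in> A)"
  have f_W: "?f w \<in> W" if "w \<in> W" for w
    using that by (auto simp: syllable_words_def)
  show ?thesis
  proof (rule word_function_invariant[where f = "\<lambda>w. word_value (?f w)", OF _ _ _ assms])
    show "word_value (?f (xs @ (v, \<one>\<^bsub>G v\<^esub>) # ys)) = word_value (?f (xs @ ys))" if "v \<in> V" "xs \<in> W" "ys \<in> W" for v xs ys
      using that f_W by (simp add: word_value_append word_value_Cons[of v "\<one>\<^bsub>G v\<^esub>"])
    show "word_value (?f (xs @ (v, g) # (v, h) # ys)) = word_value (?f (xs @ (v, g \<otimes>\<^bsub>G v\<^esub> h) # ys))"
      if "v \<in> V" "g \<in> carrier (G v)" "h \<in> carrier (G v)" "xs \<in> W" "ys \<in> W" for v g h xs ys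
      using that f_W word_value_mult[of v g h] word_value_replace_infix[of "?f xs" "?f ys" "[(v, g), (v, h)]" "[(v, g \<otimes>\<^bsub>G v\<^esub> h)]"]
      by simp
    show "word_value (?f (xs @ (v, g) # (u, h) # ys)) = word_value (?f (xs @ (u, h) # (v, g) # ys))"
      if "v \<in> V" "u \<in> V" "{v, u} \<in> E" "g \<in> carrier (G v)" "h \<in> carrier (G u)" "xs \<in> W" "ys \<in> W"
      for v u g h xs ys
      using that f_W word_value_commute[of v u g h] word_value_replace_infix[of "?f xs" "?f ys" "[(v, g), (u, h)]" "[(u, h), (v, g)]"]
      by simp
  qed
qed

text \<open>The retraction fixes the elements of the subgroup, so deleting the syllables outside \<open>A\<close> gives
  another word for the same element, and a shortest word has nothing to delete.\<close>

lemma minimal_word_over: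
  assumes w: "minimal_word w" and "word_value w \<in> word_value ` words_over A"
  shows "fst ` set w \<subseteq> A"
proof -
  let ?f = "filter (\<lambda>s. fst s \<in> A)"
  obtain u where u: "u \<in> W" "fst ` set u \<subseteq> A" "word_value w = word_value u"
    using assms(2) by (auto simp: words_over_def)
  have w_W: "w \<in> W" using w by (simp add: minimal_word_def)
  have "?f u = u" using u(2) by (auto simp: filter_id_conv)
  then have "word_value (?f w) = word_value w" using word_value_filter_syllables[OF w_W u(1,3), of A] u(3) by simp
  moreover have "?f w \<in> W" using w_W by (auto simp: syllable_words_def)
  ultimately have "length w \<le> length (?f w)" using w by (auto simp: minimal_word_def)
  then have "\<not> (\<exists>s\<in>set w. fst s \<notin> A)"
    using length_filter_less[of _ w "\<lambda>s. fst s \<in> A"] by fastforce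
  then show ?thesis by auto
qed

lemma subgroup_star_subgroup: "subgroup (star_subgroup v) \<Gamma>"
proof (rule subgroupI)
  show "star_subgroup v \<subseteq> carrier \<Gamma>" by (auto simp: star_subgroup_def words_over_def)
  have "[] \<in> words_over (star v)" by (simp add: words_over_def)
  then show "star_subgroup v \<noteq> {}" by (auto simp: star_subgroup_def)
  show "inv\<^bsub>\<Gamma>\<^esub> x \<in> star_subgroup v" if x: "x \<in> star_subgroup v" for x
  proof -
    obtain w where w: "w \<in> W" "fst ` set w \<subseteq> star v" "x = word_value w"
      using x by (auto simp: star_subgroup_def words_over_def)
    have "fst ` set (inv_word w) = fst ` set w"
      by (force simp: inv_word_def image_iff)
    then have "inv_word w \<in> words_over (star v)"
      using w by (simp add: words_over_def)
    then show ?thesis using w by (auto simp: star_subgroup_def simp flip: word_value_inv_word)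
  qed
  show "x \<otimes>\<^bsub>\<Gamma>\<^esub> y \<in> star_subgroup v" if "x \<in> star_subgroup v" "y \<in> star_subgroup v" for x y
  proof -
    from that obtain a b
      where "a \<in> words_over (star v)" "b \<in> words_over (star v)" "x = word_value a" "y = word_value b"
      unfolding star_subgroup_def by blast
    moreover from this have "a @ b \<in> words_over (star v)" by (auto simp: words_over_def)
    ultimately show ?thesis by (auto simp: star_subgroup_def words_over_def simp flip: word_value_append)
  qed
qed

lemma syllable_in_star_subgroup:
  "u \<in> star v \<Longrightarrow> u \<in> V \<Longrightarrow> s \<in> carrier (G u) \<Longrightarrow> word_value [(u, s)] \<in> star_subgroup v"
  by (auto simp: star_subgroup_def words_over_def)

text \<open>The wall crossed by the edges that leave \<open>p\<close> in the direction of \<open>G\<^sub>v\<close> is the pair of \<open>v\<close> and this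
  coset.\<close>

definition star_coset :: "'v \<Rightarrow> ('v \<times> 'a) list set set \<Rightarrow> ('v \<times> 'a) list set set set" where
  "star_coset v p = p <#\<^bsub>\<Gamma>\<^esub> star_subgroup v"

lemma star_coset_closed: "p \<in> carrier \<Gamma> \<Longrightarrow> star_coset v p \<subseteq> carrier \<Gamma>"
  unfolding star_coset_def by (intro l_coset_subset_G subgroup.subset[OF subgroup_star_subgroup])

lemma star_coset_translate:
  "x \<in> carrier \<Gamma> \<Longrightarrow> p \<in> carrier \<Gamma> \<Longrightarrow> star_coset v (x \<otimes>\<^bsub>\<Gamma>\<^esub> p) = x <#\<^bsub>\<Gamma>\<^esub> star_coset v p"
  unfolding star_coset_def by (simp add: lcos_m_assoc subgroup.subset[OF subgroup_star_subgroup])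

lemma star_coset_step:
  assumes "p \<in> carrier \<Gamma>" "s \<in> star_subgroup v"
  shows "star_coset v (p \<otimes>\<^bsub>\<Gamma>\<^esub> s) = star_coset v p"
  unfolding star_coset_def
  by (rule l_repr_independence[symmetric, OF _ assms(1) subgroup_star_subgroup])
    (use assms in \<open>auto simp: l_coset_def\<close>)

lemma star_coset_eqD:
  assumes p: "p \<in> carrier \<Gamma>" and s: "s \<in> carrier \<Gamma>" and eq: "star_coset v (p \<otimes>\<^bsub>\<Gamma>\<^esub> s) = star_coset v p"
  shows "s \<in> star_subgroup v"
proof -
  have "p \<otimes>\<^bsub>\<Gamma>\<^esub> s \<in> star_coset v (p \<otimes>\<^bsub>\<Gamma>\<^esub> s)"
    unfolding star_coset_def l_coset_def
    using p s subgroup.one_closed[OF subgroup_star_subgroup] by force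
  then obtain s' where "s' \<in> star_subgroup v" "p \<otimes>\<^bsub>\<Gamma>\<^esub> s = p \<otimes>\<^bsub>\<Gamma>\<^esub> s'"
    unfolding eq by (auto simp: star_coset_def l_coset_def)
  then show ?thesis
    using p s subgroup.mem_carrier[OF subgroup_star_subgroup, of s'] Units_l_cancel[of p s s'] by simp
qed

fun crossed_walls :: "('v \<times> 'a) list set set \<Rightarrow> ('v \<times> 'a) list \<Rightarrow> ('v \<times> ('v \<times> 'a) list set set set) list" where
  "crossed_walls p [] = []"
| "crossed_walls p ((u, s) # w) = (u, star_coset u p) # crossed_walls (p \<otimes>\<^bsub>\<Gamma>\<^esub> word_value [(u, s)]) w"

text \<open>The product of those syllables of a word that cross the wall \<open>i\<close> when the word is read as a path
  that starts at \<open>p\<close>. Syllables crossing \<open>i\<close> all belong to the vertex group of \<open>fst i\<close>.\<close>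

fun crossing :: "'v \<times> ('v \<times> 'a) list set set set \<Rightarrow> ('v \<times> 'a) list set set \<Rightarrow> ('v \<times> 'a) list \<Rightarrow> 'a" where
  "crossing i p [] = \<one>\<^bsub>G (fst i)\<^esub>"
| "crossing i p ((u, s) # w) =
    (if i = (u, star_coset u p) then s \<otimes>\<^bsub>G (fst i)\<^esub> crossing i (p \<otimes>\<^bsub>\<Gamma>\<^esub> word_value [(u, s)]) w
     else crossing i (p \<otimes>\<^bsub>\<Gamma>\<^esub> word_value [(u, s)]) w)"

lemma crossing_closed: "fst i \<in> V \<Longrightarrow> w \<in> W \<Longrightarrow> crossing i p w \<in> carrier (G (fst i))"
  by (induction w arbitrary: p) auto

lemma crossing_append:
  assumes "fst i \<in> V"
  shows "w \<in> W \<Longrightarrow> w' \<in> W \<Longrightarrow> p \<in> carrier \<Gamma> \<Longrightarrow>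
    crossing i p (w @ w') = crossing i p w \<otimes>\<^bsub>G (fst i)\<^esub> crossing i (p \<otimes>\<^bsub>\<Gamma>\<^esub> word_value w) w'"
proof (induction w arbitrary: p)
  case Nil
  interpret Gi: group "G (fst i)" by (rule grp[OF assms])
  show ?case using Nil crossing_closed[OF assms, of w'] by simp
next
  case (Cons a w)
  interpret Gi: group "G (fst i)" by (rule grp[OF assms])
  obtain u s where a: "a = (u, s)" by (cases a)
  have u: "u \<in> V" "s \<in> carrier (G u)" and w: "w \<in> W" using Cons.prems(1) a by auto
  let ?p = "p \<otimes>\<^bsub>\<Gamma>\<^esub> word_value [(u, s)]"
  have p: "?p \<in> carrier \<Gamma>" using Cons.prems u by simp
  have "?p \<otimes>\<^bsub>\<Gamma>\<^esub> word_value w = p \<otimes>\<^bsub>\<Gamma>\<^esub> word_value (a # w)"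
    using Cons.prems u w by (simp add: a m_assoc word_value_Cons[of u s w])
  then have IH: "crossing i ?p (w @ w') =
      crossing i ?p w \<otimes>\<^bsub>G (fst i)\<^esub> crossing i (p \<otimes>\<^bsub>\<Gamma>\<^esub> word_value (a # w)) w'"
    using Cons.IH[OF w Cons.prems(2) p] by simp
  show ?case
  proof (cases "i = (u, star_coset u p)")
    case True
    have step: "crossing i p (a # z) = s \<otimes>\<^bsub>G (fst i)\<^esub> crossing i ?p z" for z
      using True by (simp add: a)
    have "s \<in> carrier (G (fst i))" using u True by simp
    then show ?thesis
      unfolding append_Cons step IH
      by (rule Gi.m_assoc[symmetric]) (intro crossing_closed[OF assms] w Cons.prems(2))+
  next
    case False
    then show ?thesis using IH by (simp add: a)
  qed
qed

text \<open>A neutral syllable contributes a neutral factor. Two adjacent syllables of \<open>G\<^sub>v\<close> cross the same wall, since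
  the first does not leave the coset. Two commuting syllables cross walls of different vertices, and
  neither of them changes the wall that the other one crosses.\<close>

lemma crossing_invariant:
  assumes i: "fst i \<in> V" and p: "p \<in> carrier \<Gamma>" and "w \<in> W" "w' \<in> W" "word_value w = word_value w'"
  shows "crossing i p w = crossing i p w'"
proof -
  interpret Gi: group "G (fst i)" by (rule grp[OF i])
  have replace: "crossing i p (xs @ m @ ys) = crossing i p (xs @ m' @ ys)"
    if W: "xs \<in> W" "m \<in> W" "m' \<in> W" "ys \<in> W" and word_value: "word_value m = word_value m'"
      and eq: "\<And>q. q \<in> carrier \<Gamma> \<Longrightarrow> crossing i q m = crossing i q m'" for xs m m' ys
    using W word_value eq[of "p \<otimes>\<^bsub>\<Gamma>\<^esub> word_value xs"] p by (simp add: crossing_append[OF i])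
  show ?thesis
  proof (rule word_function_invariant[where f = "crossing i p", OF _ _ _ assms(3-)])
    show "crossing i p (xs @ (v, \<one>\<^bsub>G v\<^esub>) # ys) = crossing i p (xs @ ys)"
      if v: "v \<in> V" and W: "xs \<in> W" "ys \<in> W" for v xs ys
    proof -
      have "crossing i q [(v, \<one>\<^bsub>G v\<^esub>)] = crossing i q []" if "q \<in> carrier \<Gamma>" for q
        using monoid.l_one[OF group.is_monoid[OF grp[OF v]] one_closed_vertex[OF v]] by auto
      then show ?thesis using replace[of xs "[(v, \<one>\<^bsub>G v\<^esub>)]" "[]" ys] v W by (simp del: crossing.simps)
    qed
  next
    fix v g h xs ys
    assume v: "v \<in> V" and g: "g \<in> carrier (G v)" and h: "h \<in> carrier (G v)" and W: "xs \<in> W" "ys \<in> W"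
    have "crossing i q [(v, g), (v, h)] = crossing i q [(v, g \<otimes>\<^bsub>G v\<^esub> h)]" if q: "q \<in> carrier \<Gamma>" for q
    proof -
      have "star_coset v (q \<otimes>\<^bsub>\<Gamma>\<^esub> word_value [(v, g)]) = star_coset v q"
        using v g q by (intro star_coset_step syllable_in_star_subgroup) (auto simp: star_def)
      then show ?thesis using monoid.m_assoc[OF group.is_monoid[OF grp[OF v]] g h] v by auto
    qed
    then show "crossing i p (xs @ (v, g) # (v, h) # ys) = crossing i p (xs @ (v, g \<otimes>\<^bsub>G v\<^esub> h) # ys)"
      using replace[of xs "[(v, g), (v, h)]" "[(v, g \<otimes>\<^bsub>G v\<^esub> h)]" ys] v g h W word_value_mult[of v g h] by simp
  next
    fix v u g h xs ys
    assume v: "v \<in> V" and u: "u \<in> V" and e: "{v, u} \<in> E" and g: "g \<in> carrier (G v)"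
      and h: "h \<in> carrier (G u)" and W: "xs \<in> W" "ys \<in> W"
    have "crossing i q [(v, g), (u, h)] = crossing i q [(u, h), (v, g)]" if q: "q \<in> carrier \<Gamma>" for q
    proof -
      have "star_coset u (q \<otimes>\<^bsub>\<Gamma>\<^esub> word_value [(v, g)]) = star_coset u q"
        using v u e g q by (intro star_coset_step syllable_in_star_subgroup) (auto simp: star_def insert_commute)
      moreover have "star_coset v (q \<otimes>\<^bsub>\<Gamma>\<^esub> word_value [(u, h)]) = star_coset v q"
        using v u e h q by (intro star_coset_step syllable_in_star_subgroup) (auto simp: star_def)
      ultimately show ?thesis using adjacent_distinct[OF e] by auto
    qed
    then show "crossing i p (xs @ (v, g) # (u, h) # ys) = crossing i p (xs @ (u, h) # (v, g) # ys)"
      using replace[of xs "[(v, g), (u, h)]" "[(u, h), (v, g)]" ys] v u g h W word_value_commute[OF v u e g h] by simp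
  qed
qed

lemma lcoset_inverse:
  assumes "x \<in> carrier \<Gamma>" "C \<subseteq> carrier \<Gamma>"
  shows "inv\<^bsub>\<Gamma>\<^esub> x <#\<^bsub>\<Gamma>\<^esub> (x <#\<^bsub>\<Gamma>\<^esub> C) = C" "x <#\<^bsub>\<Gamma>\<^esub> (inv\<^bsub>\<Gamma>\<^esub> x <#\<^bsub>\<Gamma>\<^esub> C) = C"
  using assms by (simp_all add: lcos_m_assoc lcos_mult_one)

lemma crossing_translate:
  assumes x: "x \<in> carrier \<Gamma>" and C: "C \<subseteq> carrier \<Gamma>"
  shows "w \<in> W \<Longrightarrow> p \<in> carrier \<Gamma> \<Longrightarrow>
    crossing (v, x <#\<^bsub>\<Gamma>\<^esub> C) (x \<otimes>\<^bsub>\<Gamma>\<^esub> p) w = crossing (v, C) p w"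
proof (induction w arbitrary: p)
  case (Cons a w)
  obtain u s where a: "a = (u, s)" by (cases a)
  have u: "u \<in> V" "s \<in> carrier (G u)" and w: "w \<in> W" using Cons.prems(1) a by auto
  have "x <#\<^bsub>\<Gamma>\<^esub> C = star_coset u (x \<otimes>\<^bsub>\<Gamma>\<^esub> p) \<longleftrightarrow> C = star_coset u p"
    using lcoset_inverse(1)[OF x C] lcoset_inverse(1)[OF x star_coset_closed[OF Cons.prems(2)], of u]
      star_coset_translate[OF x Cons.prems(2), of u] by metis
  moreover have "x \<otimes>\<^bsub>\<Gamma>\<^esub> p \<otimes>\<^bsub>\<Gamma>\<^esub> word_value [(u, s)] = x \<otimes>\<^bsub>\<Gamma>\<^esub> (p \<otimes>\<^bsub>\<Gamma>\<^esub> word_value [(u, s)])"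
    using x u Cons.prems by (simp add: m_assoc)
  ultimately show ?case using Cons.IH[OF w, of "p \<otimes>\<^bsub>\<Gamma>\<^esub> word_value [(u, s)]"] u Cons.prems by (auto simp: a)
qed simp

lemma crossing_not_in_crossed_walls:
  "i \<notin> set (crossed_walls p w) \<Longrightarrow> crossing i p w = \<one>\<^bsub>G (fst i)\<^esub>"
  by (induction p w rule: crossed_walls.induct) auto

lemma crossed_walls_memD:
  "i \<in> set (crossed_walls p w) \<Longrightarrow> w \<in> W \<Longrightarrow> p \<in> carrier \<Gamma> \<Longrightarrow>
    \<exists>m t y. w = m @ (fst i, t) # y \<and> snd i = star_coset (fst i) (p \<otimes>\<^bsub>\<Gamma>\<^esub> word_value m)"
proof (induction p w rule: crossed_walls.induct)
  case (2 p u s w)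
  have u: "u \<in> V" "s \<in> carrier (G u)" and w: "w \<in> W" using "2.prems" by auto
  show ?case
  proof (cases "i = (u, star_coset u p)")
    case True
    then have "(u, s) # w = [] @ (fst i, s) # w" "snd i = star_coset (fst i) (p \<otimes>\<^bsub>\<Gamma>\<^esub> word_value [])"
      using "2.prems" by simp_all
    then show ?thesis by blast
  next
    case False
    then obtain m t y where m: "w = m @ (fst i, t) # y"
      "snd i = star_coset (fst i) (p \<otimes>\<^bsub>\<Gamma>\<^esub> word_value [(u, s)] \<otimes>\<^bsub>\<Gamma>\<^esub> word_value m)"
      using "2.IH" "2.prems" u w by auto
    then have "(u, s) # w = ((u, s) # m) @ (fst i, t) # y"
      "snd i = star_coset (fst i) (p \<otimes>\<^bsub>\<Gamma>\<^esub> word_value ((u, s) # m))"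
      using "2.prems" u w by (simp_all add: m_assoc word_value_Cons[of u s m])
    then show ?thesis by blast
  qed
qed simp

text \<open>Every syllable of \<open>m\<close> either commutes with the syllable \<open>(v, s)\<close>, which then moves past it, or
  belongs to \<open>G\<^sub>v\<close> and can be absorbed. In the end \<open>(v, s)\<close> meets \<open>(v, t)\<close> and a syllable is saved.\<close>

lemma merge_across_star:
  assumes "fst ` set m \<subseteq> star v" "m \<in> W" "v \<in> V" "s \<in> carrier (G v)" "t \<in> carrier (G v)"
  shows "\<exists>m'\<in>W. word_value m' = word_value ((v, s) # m @ [(v, t)]) \<and> length m' \<le> length m + 1"
  using assms
proof (induction m arbitrary: s)
  case Nil
  then show ?case using word_value_mult[of v s t] by (intro bexI[of _ "[(v, s \<otimes>\<^bsub>G v\<^esub> t)]"]) auto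
next
  case (Cons a m)
  obtain u x where a: "a = (u, x)" by (cases a)
  have u: "u \<in> V" "x \<in> carrier (G u)" "m \<in> W" "u \<in> star v" "fst ` set m \<subseteq> star v"
    using Cons.prems a by auto
  show ?case
  proof (cases "u = v")
    case True
    obtain m' where m': "m' \<in> W" "word_value m' = word_value ((v, s \<otimes>\<^bsub>G v\<^esub> x) # m @ [(v, t)])" "length m' \<le> length m + 1"
      using Cons.IH[of "s \<otimes>\<^bsub>G v\<^esub> x"] Cons.prems u True by auto
    have "word_value ((v, s) # (v, x) # m @ [(v, t)]) = word_value ((v, s \<otimes>\<^bsub>G v\<^esub> x) # m @ [(v, t)])"
      using word_value_replace_infix[of "[]" "m @ [(v, t)]" "[(v, s), (v, x)]" "[(v, s \<otimes>\<^bsub>G v\<^esub> x)]"]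
        word_value_mult[of v s x] Cons.prems u True by simp
    then show ?thesis using m' a True by (intro bexI[of _ m']) auto
  next
    case False
    then have e: "{v, u} \<in> E" using u by (auto simp: star_def)
    obtain m' where m': "m' \<in> W" "word_value m' = word_value ((v, s) # m @ [(v, t)])" "length m' \<le> length m + 1"
      using Cons.IH[of s] Cons.prems u by auto
    have "word_value ((v, s) # (u, x) # m @ [(v, t)]) = word_value ((u, x) # (v, s) # m @ [(v, t)])"
      using word_value_replace_infix[of "[]" "m @ [(v, t)]" "[(v, s), (u, x)]" "[(u, x), (v, s)]"]
        word_value_commute[OF _ _ e, of s x] Cons.prems u by simp
    also have "\<dots> = word_value ((u, x) # m')"
      using word_value_Cons[of u x "(v, s) # m @ [(v, t)]"] word_value_Cons[of u x m'] m' Cons.prems u by simp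
    finally show ?thesis using m' a u by (intro bexI[of _ "(u, x) # m'"]) auto
  qed
qed

text \<open>If the first syllable \<open>(u, s)\<close> crosses the same wall as a later one, the part of the word between
  them represents an element of the star subgroup. Being shortest, this part consists of syllables of
  the star, and the two syllables can be merged.\<close>

theorem distinct_crossed_walls_minimal_word:
  "minimal_word w \<Longrightarrow> p \<in> carrier \<Gamma> \<Longrightarrow> distinct (crossed_walls p w)"
proof (induction p w rule: crossed_walls.induct)
  case (2 p u s w)
  have W: "u \<in> V" "s \<in> carrier (G u)" "w \<in> W"
    using "2.prems" by (auto simp: minimal_word_def)
  let ?p = "p \<otimes>\<^bsub>\<Gamma>\<^esub> word_value [(u, s)]"
  have p: "?p \<in> carrier \<Gamma>" using W "2.prems" by simp
  have "minimal_word w" using minimal_word_infix[of "[(u, s)]" w "[]"] "2.prems" by simp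
  then have "distinct (crossed_walls ?p w)" using "2.IH" p by simp
  moreover have "(u, star_coset u p) \<notin> set (crossed_walls ?p w)"
  proof
    assume "(u, star_coset u p) \<in> set (crossed_walls ?p w)"
    then obtain m t y where w: "w = m @ (u, t) # y" and eq: "star_coset u p = star_coset u (?p \<otimes>\<^bsub>\<Gamma>\<^esub> word_value m)"
      using crossed_walls_memD[of "(u, star_coset u p)" ?p w] W p by auto
    have m: "m \<in> W" "t \<in> carrier (G u)" using W w by auto
    have "?p \<otimes>\<^bsub>\<Gamma>\<^esub> word_value m = p \<otimes>\<^bsub>\<Gamma>\<^esub> word_value ((u, s) # m)"
      using m W "2.prems" by (simp add: m_assoc word_value_Cons[of u s m])
    then have "word_value ((u, s) # m) \<in> star_subgroup u"
      using star_coset_eqD[of p "word_value ((u, s) # m)" u] eq m W "2.prems" by simp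
    moreover have "minimal_word ((u, s) # m)"
      using minimal_word_infix[of "[]" "(u, s) # m" "(u, t) # y"] "2.prems" w by simp
    ultimately have "fst ` set m \<subseteq> star u"
      using minimal_word_over[of "(u, s) # m" "star u"] by (simp add: star_subgroup_def)
    then obtain m' where "m' \<in> W" "word_value m' = word_value ((u, s) # m @ [(u, t)])" "length m' \<le> length m + 1"
      using merge_across_star[of m u s t] m W by auto
    moreover have "minimal_word ((u, s) # m @ [(u, t)])"
      using minimal_word_infix[of "[]" "(u, s) # m @ [(u, t)]" y] "2.prems" w by simp
    ultimately show False by (auto simp: minimal_word_def)
  qed
  ultimately show ?case by simp
qed simp

end

section \<open>The kernel of a graph product\<close>

text \<open>The map \<open>\<phi>\<close> may identify points; the coefficients over each fibre are added up.\<close>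

lemma positive_semidefinite_on_pullback:
  assumes K: "positive_semidefinite_on X K" and \<phi>: "\<And>y. y \<in> Y \<Longrightarrow> \<phi> y \<in> X"
  shows "positive_semidefinite_on Y (\<lambda>a b. K (\<phi> a) (\<phi> b))"
  unfolding positive_semidefinite_on_def
proof (intro conjI ballI allI impI)
  show "K (\<phi> a) (\<phi> b) = K (\<phi> b) (\<phi> a)" if "a \<in> Y" "b \<in> Y" for a b
    using that \<phi> by (intro positive_semidefinite_on_commute[OF K])
  fix F and c :: "_ \<Rightarrow> real" assume F: "finite F" "F \<subseteq> Y"
  define C where "C x = (\<Sum>a\<in>{a \<in> F. \<phi> a = x}. c a)" for x
  have group: "(\<Sum>a\<in>F. c a * f (\<phi> a)) = (\<Sum>x\<in>\<phi> ` F. C x * f x)" for f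
    unfolding C_def sum_distrib_right by (subst sum.image_gen[OF F(1), of _ \<phi>]) (auto intro!: sum.cong)
  have "0 \<le> (\<Sum>x\<in>\<phi> ` F. \<Sum>y\<in>\<phi> ` F. C x * C y * K x y)"
    using F \<phi> by (intro positive_semidefinite_onD[OF K]) auto
  also have "\<dots> = (\<Sum>x\<in>\<phi> ` F. C x * (\<Sum>y\<in>\<phi> ` F. C y * K x y))"
    by (simp add: sum_distrib_left mult.assoc)
  also have "\<dots> = (\<Sum>a\<in>F. c a * (\<Sum>b\<in>F. c b * K (\<phi> a) (\<phi> b)))"
    by (simp only: group group[where f = "\<lambda>z. \<Sum>y\<in>\<phi> ` F. C y * K z y"])
  also have "\<dots> = (\<Sum>a\<in>F. \<Sum>b\<in>F. c a * c b * K (\<phi> a) (\<phi> b))"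
    by (simp add: sum_distrib_left mult.assoc)
  finally show "0 \<le> (\<Sum>a\<in>F. \<Sum>b\<in>F. c a * c b * K (\<phi> a) (\<phi> b))" .
qed

lemma orbit_kernel_add:
  assumes "orbit_kernel G K" "orbit_kernel G L"
  shows "orbit_kernel G (\<lambda>g h. K g h + L g h)"
proof -
  have "kernel_dist (\<lambda>g h. K g h + L g h) g h = kernel_dist K g h + kernel_dist L g h" for g h
    by (simp add: kernel_dist_def)
  moreover have "positive_semidefinite_on (carrier G) (\<lambda>g h. K g h + L g h)"
    using assms by (auto simp: orbit_kernel_def positive_semidefinite_on_def distrib_left sum.distrib)
  ultimately show ?thesis using assms by (simp add: orbit_kernel_def)
qed

lemma orbit_kernel_scale:
  assumes "orbit_kernel G K" "0 \<le> r"
  shows "orbit_kernel G (\<lambda>g h. r * K g h)"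
proof -
  have "kernel_dist (\<lambda>g h. r * K g h) g h = r * kernel_dist K g h" for g h
    by (simp add: kernel_dist_def algebra_simps)
  moreover have "positive_semidefinite_on (carrier G) (\<lambda>g h. r * K g h)"
    using assms
    by (auto simp: orbit_kernel_def positive_semidefinite_on_def mult.left_commute[of _ r]
        simp flip: sum_distrib_left)
  ultimately show ?thesis using assms by (simp add: orbit_kernel_def)
qed

text \<open>The kernel of the squared distance that is \<open>1\<close> between distinct elements. It serves to make the
  kernels of the vertex groups large away from the neutral element.\<close>

definition discrete_kernel :: "('a, 'm) monoid_scheme \<Rightarrow> 'a \<Rightarrow> 'a \<Rightarrow> real" where
  "discrete_kernel G g h = (if g = \<one>\<^bsub>G\<^esub> \<or> h = \<one>\<^bsub>G\<^esub> then 0 else if g = h then 1 else 1 / 2)"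

text \<open>The quadratic form of this kernel at \<open>c\<close> is half of the square of the sum, plus half of the sum of the
  squares, of the coefficients of \<open>c\<close> at nontrivial elements.\<close>

lemma orbit_kernel_discrete:
  fixes G :: "('a, 'm) monoid_scheme"
  assumes "group G"
  shows "orbit_kernel G (discrete_kernel G)"
  unfolding orbit_kernel_def
proof (intro conjI ballI)
  interpret group G by fact
  show "discrete_kernel G \<one>\<^bsub>G\<^esub> g = 0" for g
    by (simp add: discrete_kernel_def)
  have "kernel_dist (discrete_kernel G) g h = (if g = h then 0 else 1)" for g h
    by (simp add: kernel_dist_def discrete_kernel_def)
  then show "kernel_dist (discrete_kernel G) (x \<otimes>\<^bsub>G\<^esub> g) (x \<otimes>\<^bsub>G\<^esub> h) = kernel_dist (discrete_kernel G) g h"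
    if "x \<in> carrier G" "g \<in> carrier G" "h \<in> carrier G" for x g h
    using that Units_l_cancel[of x g h] by simp
  show "positive_semidefinite_on (carrier G) (discrete_kernel G)"
    unfolding positive_semidefinite_on_def
  proof (intro conjI ballI allI impI)
    show "discrete_kernel G g h = discrete_kernel G h g" for g h
      by (auto simp: discrete_kernel_def)
    fix F :: "'a set" and c :: "'a \<Rightarrow> real" assume F: "finite F"
    define e where "e g = (if g = \<one>\<^bsub>G\<^esub> then 0 else c g)" for g
    have "(\<Sum>g\<in>F. \<Sum>h\<in>F. c g * c h * discrete_kernel G g h) =
        (\<Sum>g\<in>F. \<Sum>h\<in>F. e g * e h / 2 + (if g = h then e g * e g / 2 else 0))"
      by (intro sum.cong) (auto simp: discrete_kernel_def e_def)
    also have "\<dots> = (\<Sum>g\<in>F. e g)\<^sup>2 / 2 + (\<Sum>g\<in>F. e g * e g / 2)"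
      using F by (simp add: sum.distrib power2_eq_square sum_product sum_divide_distrib)
    also have "\<dots> \<ge> 0"
      by (intro add_nonneg_nonneg sum_nonneg) auto
    finally show "0 \<le> (\<Sum>g\<in>F. \<Sum>h\<in>F. c g * c h * discrete_kernel G g h)" .
  qed
qed

context graph_of_groups
begin

text \<open>All subsets are admitted in place of cosets of star subgroups. The coordinates at the others are
  trivial, and the set is visibly closed under translation.\<close>

definition walls :: "('v \<times> ('v \<times> 'a) list set set set) set" where
  "walls = V \<times> Pow (carrier \<Gamma>)"

definition min_word :: "('v \<times> 'a) list set set \<Rightarrow> ('v \<times> 'a) list" where
  "min_word g = (SOME w. minimal_word w \<and> word_value w = g)"

lemma min_word:
  assumes "g \<in> carrier \<Gamma>"
  shows "minimal_word (min_word g)" "word_value (min_word g) = g" "min_word g \<in> W"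
  using someI_ex[OF ex_minimal_word[OF assms]] unfolding min_word_def minimal_word_def by auto

definition coordinate :: "'v \<times> ('v \<times> 'a) list set set set \<Rightarrow> ('v \<times> 'a) list set set \<Rightarrow> 'a" where
  "coordinate i g = crossing i \<one>\<^bsub>\<Gamma>\<^esub> (min_word g)"

lemma coordinate_closed: "i \<in> walls \<Longrightarrow> g \<in> carrier \<Gamma> \<Longrightarrow> coordinate i g \<in> carrier (G (fst i))"
  unfolding coordinate_def by (rule crossing_closed) (auto simp: walls_def min_word)

lemma coordinate_word_value:
  assumes "i \<in> walls" "w \<in> W"
  shows "coordinate i (word_value w) = crossing i \<one>\<^bsub>\<Gamma>\<^esub> w"
  unfolding coordinate_def
  by (rule crossing_invariant) (use assms min_word[of "word_value w"] in \<open>auto simp: walls_def\<close>)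

definition translate ::
    "('v \<times> 'a) list set set \<Rightarrow> 'v \<times> ('v \<times> 'a) list set set set \<Rightarrow> 'v \<times> ('v \<times> 'a) list set set set" where
  "translate x i = (fst i, x <#\<^bsub>\<Gamma>\<^esub> snd i)"

lemma fst_translate [simp]: "fst (translate x i) = fst i"
  by (simp add: translate_def)

lemma translate_walls: "x \<in> carrier \<Gamma> \<Longrightarrow> i \<in> walls \<Longrightarrow> translate x i \<in> walls"
  by (auto simp: translate_def walls_def l_coset_def)

lemma translate_inverse:
  assumes "x \<in> carrier \<Gamma>" "i \<in> walls"
  shows "translate (inv\<^bsub>\<Gamma>\<^esub> x) (translate x i) = i" "translate x (translate (inv\<^bsub>\<Gamma>\<^esub> x) i) = i"
  using assms by (auto simp: translate_def walls_def lcoset_inverse)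

text \<open>Read a word for \<open>x\<close> followed by one for \<open>g\<close>. The second word is a path from \<open>x\<close>, that is, a
  translate by \<open>x\<close> of a path from the origin.\<close>

lemma coordinate_mult:
  assumes x: "x \<in> carrier \<Gamma>" and g: "g \<in> carrier \<Gamma>" and i: "i \<in> walls"
  shows "coordinate (translate x i) (x \<otimes>\<^bsub>\<Gamma>\<^esub> g) =
    coordinate (translate x i) x \<otimes>\<^bsub>G (fst i)\<^esub> coordinate i g"
proof -
  obtain v C where vC: "i = (v, C)" "v \<in> V" "C \<subseteq> carrier \<Gamma>" using i by (auto simp: walls_def)
  let ?x = "min_word x" and ?g = "min_word g"
  have "coordinate (translate x i) (word_value (?x @ ?g)) = crossing (translate x i) \<one>\<^bsub>\<Gamma>\<^esub> (?x @ ?g)"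
    using x g i by (intro coordinate_word_value translate_walls) (auto simp: min_word)
  also have "\<dots> = crossing (translate x i) \<one>\<^bsub>\<Gamma>\<^esub> ?x \<otimes>\<^bsub>G v\<^esub> crossing (translate x i) (x \<otimes>\<^bsub>\<Gamma>\<^esub> \<one>\<^bsub>\<Gamma>\<^esub>) ?g"
    using x g vC crossing_append[of "translate x i" ?x ?g "\<one>\<^bsub>\<Gamma>\<^esub>"] by (simp add: min_word)
  also have "crossing (translate x i) (x \<otimes>\<^bsub>\<Gamma>\<^esub> \<one>\<^bsub>\<Gamma>\<^esub>) ?g = coordinate i g"
    using crossing_translate[OF x vC(3), of ?g "\<one>\<^bsub>\<Gamma>\<^esub>" v] g vC
    by (simp add: min_word coordinate_def translate_def)
  finally show ?thesis using x g vC by (simp add: word_value_append min_word coordinate_def)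
qed

text \<open>An element has a nontrivial coordinate only at the walls that a word for it crosses; so the sums over
  walls below are finite.\<close>

definition support :: "('v \<times> 'a) list set set \<Rightarrow> ('v \<times> ('v \<times> 'a) list set set set) set" where
  "support g = {i \<in> walls. coordinate i g \<noteq> \<one>\<^bsub>G (fst i)\<^esub>}"

lemma support_subset_crossed_walls: "support g \<subseteq> set (crossed_walls \<one>\<^bsub>\<Gamma>\<^esub> (min_word g))"
  using crossing_not_in_crossed_walls by (auto simp: support_def coordinate_def)

lemma finite_support: "finite (support g)"
  by (rule finite_subset[OF support_subset_crossed_walls]) simp

lemma support_walls: "support g \<subseteq> walls"
  by (auto simp: support_def)

lemma support_one: "support \<one>\<^bsub>\<Gamma>\<^esub> = {}"
  using coordinate_word_value[of _ "[]"] by (auto simp: support_def)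

lemma crossed_walls_walls: "w \<in> W \<Longrightarrow> p \<in> carrier \<Gamma> \<Longrightarrow> set (crossed_walls p w) \<subseteq> walls"
  by (induction p w rule: crossed_walls.induct) (auto simp: walls_def subsetD[OF star_coset_closed])

end

locale graph_of_kernels = graph_of_groups V E G
  for V :: "'v set" and E :: "'v set set" and G :: "'v \<Rightarrow> ('a, 'm) monoid_scheme" +
  fixes k :: "'v \<Rightarrow> 'a \<Rightarrow> 'a \<Rightarrow> real"
  assumes kernel: "\<And>v. v \<in> V \<Longrightarrow> orbit_kernel (G v) (k v)"
begin

definition wall_kernel where
  "wall_kernel i g h = k (fst i) (coordinate i g) (coordinate i h)"

text \<open>At a wall outside the support of \<open>g\<close> the coordinate of \<open>g\<close> is neutral and the vertex kernel vanishes,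
  so this is the sum over all walls.\<close>

definition product_kernel where
  "product_kernel g h = (\<Sum>i\<in>support g. wall_kernel i g h)"

lemma kernel_one:
  assumes "v \<in> V" "g \<in> carrier (G v)"
  shows "k v \<one>\<^bsub>G v\<^esub> g = 0" "k v g \<one>\<^bsub>G v\<^esub> = 0"
  using kernel[OF assms(1)] assms
    positive_semidefinite_on_commute[of "carrier (G v)" "k v" g "\<one>\<^bsub>G v\<^esub>"]
  by (auto simp: orbit_kernel_def)

lemma product_kernel_superset:
  assumes "finite S" "S \<subseteq> walls" "support g \<subseteq> S" "g \<in> carrier \<Gamma>" "h \<in> carrier \<Gamma>"
  shows "product_kernel g h = (\<Sum>i\<in>S. wall_kernel i g h)"
  unfolding product_kernel_def
proof (rule sum.mono_neutral_left)
  show "\<forall>i\<in>S - support g. wall_kernel i g h = 0"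
  proof
    fix i assume i: "i \<in> S - support g"
    then have "i \<in> walls" "coordinate i g = \<one>\<^bsub>G (fst i)\<^esub>" using assms by (auto simp: support_def)
    then show "wall_kernel i g h = 0"
      using kernel_one[of "fst i" "coordinate i h"] coordinate_closed[of i h] assms
      by (auto simp: wall_kernel_def walls_def)
  qed
qed (use assms in auto)

lemma positive_semidefinite_on_wall_kernel:
  assumes "i \<in> walls"
  shows "positive_semidefinite_on (carrier \<Gamma>) (wall_kernel i)"
proof -
  have "positive_semidefinite_on (carrier (G (fst i))) (k (fst i))"
    using kernel[of "fst i"] assms by (auto simp: orbit_kernel_def walls_def)
  from positive_semidefinite_on_pullback[OF this coordinate_closed[OF assms]]
  show ?thesis by (simp add: wall_kernel_def[abs_def])
qed

lemma positive_semidefinite_on_product_kernel: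
  "positive_semidefinite_on (carrier \<Gamma>) product_kernel"
  unfolding positive_semidefinite_on_def
proof (intro conjI ballI allI impI)
  fix g h assume g: "g \<in> carrier \<Gamma>" and h: "h \<in> carrier \<Gamma>"
  let ?S = "support g \<union> support h"
  have S: "finite ?S" "?S \<subseteq> walls" "support g \<subseteq> ?S" "support h \<subseteq> ?S"
    using finite_support support_walls by auto
  have "product_kernel g h = (\<Sum>i\<in>?S. wall_kernel i g h)"
    by (rule product_kernel_superset[OF S(1-3) g h])
  also have "\<dots> = (\<Sum>i\<in>?S. wall_kernel i h g)"
    using S(2) g h
    by (intro sum.cong HOL.refl positive_semidefinite_on_commute[OF positive_semidefinite_on_wall_kernel]) auto
  also have "\<dots> = product_kernel h g"
    by (rule product_kernel_superset[OF S(1,2,4) h g, symmetric])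
  finally show "product_kernel g h = product_kernel h g" .
next
  fix F and c :: "_ \<Rightarrow> real" assume F: "finite F" "F \<subseteq> carrier \<Gamma>"
  define S where "S = (\<Union>g\<in>F. support g)"
  have S: "finite S" "S \<subseteq> walls" "\<And>g. g \<in> F \<Longrightarrow> support g \<subseteq> S"
    using F finite_support support_walls by (auto simp: S_def)
  have "(\<Sum>g\<in>F. \<Sum>h\<in>F. c g * c h * product_kernel g h) =
      (\<Sum>g\<in>F. \<Sum>h\<in>F. \<Sum>i\<in>S. c g * c h * wall_kernel i g h)"
    using F S by (intro sum.cong HOL.refl) (auto simp: product_kernel_superset sum_distrib_left subsetD)
  also have "\<dots> = (\<Sum>g\<in>F. \<Sum>i\<in>S. \<Sum>h\<in>F. c g * c h * wall_kernel i g h)"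
    by (intro sum.cong HOL.refl sum.swap)
  also have "\<dots> = (\<Sum>i\<in>S. \<Sum>g\<in>F. \<Sum>h\<in>F. c g * c h * wall_kernel i g h)"
    by (rule sum.swap)
  also have "\<dots> \<ge> 0"
    using F S(2) by (intro sum_nonneg positive_semidefinite_onD[OF positive_semidefinite_on_wall_kernel]) auto
  finally show "0 \<le> (\<Sum>g\<in>F. \<Sum>h\<in>F. c g * c h * product_kernel g h)" .
qed

lemma product_kernel_dist:
  assumes S: "finite S" "S \<subseteq> walls" "support g \<subseteq> S" "support h \<subseteq> S"
    and g: "g \<in> carrier \<Gamma>" and h: "h \<in> carrier \<Gamma>"
  shows "kernel_dist product_kernel g h = (\<Sum>i\<in>S. kernel_dist (k (fst i)) (coordinate i g) (coordinate i h))"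
  using product_kernel_superset[OF S(1-3) g g] product_kernel_superset[OF S(1-3) g h]
    product_kernel_superset[OF S(1,2,4) h h]
  by (simp add: kernel_dist_def wall_kernel_def sum.distrib sum_subtractf sum_distrib_left)

text \<open>By \<open>coordinate_mult\<close>, the translate of a wall \<open>i\<close> sees the coordinates of \<open>g\<close> and \<open>h\<close> at \<open>i\<close>, both multiplied
  from the left by the same element; this does not change their distance. Summing over the walls, the
  translation is a change of variables.\<close>

lemma product_kernel_dist_translate:
  assumes x: "x \<in> carrier \<Gamma>" and g: "g \<in> carrier \<Gamma>" and h: "h \<in> carrier \<Gamma>"
  shows "kernel_dist product_kernel (x \<otimes>\<^bsub>\<Gamma>\<^esub> g) (x \<otimes>\<^bsub>\<Gamma>\<^esub> h) = kernel_dist product_kernel g h"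
proof -
  \<comment> \<open>a finite set of walls that supports both sides of the equation\<close>
  define S where "S = support g \<union> support h \<union>
    translate (inv\<^bsub>\<Gamma>\<^esub> x) ` (support (x \<otimes>\<^bsub>\<Gamma>\<^esub> g) \<union> support (x \<otimes>\<^bsub>\<Gamma>\<^esub> h))"
  have "translate (inv\<^bsub>\<Gamma>\<^esub> x) ` support y \<subseteq> walls" for y
    using translate_walls[OF inv_closed[OF x]] support_walls[of y] by blast
  then have S: "finite S" "S \<subseteq> walls" "support g \<subseteq> S" "support h \<subseteq> S"
    using finite_support support_walls unfolding S_def by (simp_all add: image_Un) blast+
  have sub: "support y \<subseteq> translate x ` S" if "y = x \<otimes>\<^bsub>\<Gamma>\<^esub> g \<or> y = x \<otimes>\<^bsub>\<Gamma>\<^esub> h" for y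
  proof
    fix i assume i: "i \<in> support y"
    then have "i = translate x (translate (inv\<^bsub>\<Gamma>\<^esub> x) i)"
      using translate_inverse(2)[OF x] support_walls by (metis subsetD)
    moreover have "translate (inv\<^bsub>\<Gamma>\<^esub> x) i \<in> S" using i that by (auto simp: S_def)
    ultimately show "i \<in> translate x ` S" by blast
  qed
  have inj: "inj_on (translate x) S"
    by (rule inj_on_inverseI[where g = "translate (inv\<^bsub>\<Gamma>\<^esub> x)"])
      (use S(2) translate_inverse(1)[OF x] in auto)
  have "kernel_dist product_kernel (x \<otimes>\<^bsub>\<Gamma>\<^esub> g) (x \<otimes>\<^bsub>\<Gamma>\<^esub> h) =
      (\<Sum>i\<in>translate x ` S. kernel_dist (k (fst i)) (coordinate i (x \<otimes>\<^bsub>\<Gamma>\<^esub> g)) (coordinate i (x \<otimes>\<^bsub>\<Gamma>\<^esub> h)))"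
    using S x g h translate_walls[OF x] sub by (intro product_kernel_dist) auto
  also have "\<dots> = (\<Sum>i\<in>S. kernel_dist (k (fst i)) (coordinate (translate x i) (x \<otimes>\<^bsub>\<Gamma>\<^esub> g))
      (coordinate (translate x i) (x \<otimes>\<^bsub>\<Gamma>\<^esub> h)))"
    by (simp add: sum.reindex[OF inj])
  also have "\<dots> = (\<Sum>i\<in>S. kernel_dist (k (fst i)) (coordinate i g) (coordinate i h))"
  proof (rule sum.cong[OF HOL.refl])
    fix i assume "i \<in> S"
    then have i: "i \<in> walls" "fst i \<in> V" using S(2) by (auto simp: walls_def)
    show "kernel_dist (k (fst i)) (coordinate (translate x i) (x \<otimes>\<^bsub>\<Gamma>\<^esub> g))
        (coordinate (translate x i) (x \<otimes>\<^bsub>\<Gamma>\<^esub> h)) = kernel_dist (k (fst i)) (coordinate i g) (coordinate i h)"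
      using kernel[OF i(2)] coordinate_closed[OF i(1) g] coordinate_closed[OF i(1) h]
        coordinate_closed[OF translate_walls[OF x i(1)] x]
      by (simp add: coordinate_mult[OF x _ i(1)] g h orbit_kernel_def)
  qed
  also have "\<dots> = kernel_dist product_kernel g h"
    by (rule product_kernel_dist[OF S g h, symmetric])
  finally show ?thesis .
qed

lemma orbit_kernel_product_kernel: "orbit_kernel \<Gamma> product_kernel"
  unfolding orbit_kernel_def
  using positive_semidefinite_on_product_kernel product_kernel_dist_translate
  by (auto simp: product_kernel_def support_one)

lemma sum_crossing_eq_sum_syllables:
  "w \<in> W \<Longrightarrow> distinct (crossed_walls p w) \<Longrightarrow>
    (\<Sum>i\<in>set (crossed_walls p w). k (fst i) (crossing i p w) (crossing i p w)) = (\<Sum>(v, s)\<leftarrow>w. k v s s)"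
proof (induction p w rule: crossed_walls.induct)
  case (2 p u s w)
  let ?i = "(u, star_coset u p)" and ?p = "p \<otimes>\<^bsub>\<Gamma>\<^esub> word_value [(u, s)]"
  have u: "u \<in> V" "s \<in> carrier (G u)" using "2.prems" by auto
  have notin: "?i \<notin> set (crossed_walls ?p w)" using "2.prems" by simp
  have "crossing ?i p ((u, s) # w) = s"
    using crossing_not_in_crossed_walls[OF notin] u group.is_monoid[OF grp[OF u(1)]] by (simp add: monoid.r_one)
  moreover have "(\<Sum>i\<in>set (crossed_walls ?p w). k (fst i) (crossing i p ((u, s) # w)) (crossing i p ((u, s) # w))) =
      (\<Sum>i\<in>set (crossed_walls ?p w). k (fst i) (crossing i ?p w) (crossing i ?p w))"
    using notin by (intro sum.cong) auto
  ultimately show ?case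
    using notin "2.IH" "2.prems" by (simp del: crossing.simps)
qed simp

lemma product_kernel_diag:
  assumes g: "g \<in> carrier \<Gamma>"
  shows "product_kernel g g = (\<Sum>(v, s)\<leftarrow>min_word g. k v s s)"
proof -
  let ?w = "min_word g"
  have "product_kernel g g = (\<Sum>i\<in>set (crossed_walls \<one>\<^bsub>\<Gamma>\<^esub> ?w). wall_kernel i g g)"
    using g by (intro product_kernel_superset support_subset_crossed_walls crossed_walls_walls min_word) auto
  also have "\<dots> = (\<Sum>(v, s)\<leftarrow>?w. k v s s)"
    unfolding wall_kernel_def coordinate_def
    using g by (intro sum_crossing_eq_sum_syllables distinct_crossed_walls_minimal_word min_word) auto
  finally show ?thesis .
qed

text \<open>A shortest word for an element with \<open>K g g \<le> M\<close> has at most \<open>M\<close> syllables, and each of them lies in the finite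
  set of syllables of size at most \<open>M\<close>.\<close>

theorem proper_product_kernel:
  assumes large: "\<And>v s. v \<in> V \<Longrightarrow> s \<in> carrier (G v) \<Longrightarrow> s \<noteq> \<one>\<^bsub>G v\<^esub> \<Longrightarrow> 1 \<le> k v s s"
    and finite: "\<And>M. finite {(v, s). v \<in> V \<and> s \<in> carrier (G v) \<and> s \<noteq> \<one>\<^bsub>G v\<^esub> \<and> k v s s \<le> M}"
  shows "proper_kernel \<Gamma> product_kernel"
  unfolding proper_kernel_def
proof
  fix M
  define A where "A = {(v, s). v \<in> V \<and> s \<in> carrier (G v) \<and> s \<noteq> \<one>\<^bsub>G v\<^esub> \<and> k v s s \<le> M}"
  have finite_A: "finite A" unfolding A_def by (rule finite)
  have "{g \<in> carrier \<Gamma>. product_kernel g g \<le> M} \<subseteq> word_value ` {w. set w \<subseteq> A \<and> length w \<le> nat \<lfloor>M\<rfloor>}"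
  proof
    fix g assume "g \<in> {g \<in> carrier \<Gamma>. product_kernel g g \<le> M}"
    then have g: "g \<in> carrier \<Gamma>" and "product_kernel g g \<le> M"
      by simp_all
    then have M: "(\<Sum>(v, s)\<leftarrow>min_word g. k v s s) \<le> M"
      by (simp add: product_kernel_diag)
    let ?w = "min_word g"
    have syl: "v \<in> V" "s \<in> carrier (G v)" "s \<noteq> \<one>\<^bsub>G v\<^esub>" if "(v, s) \<in> set ?w" for v s
      using that min_word[OF g] minimal_word_syllable_nontrivial by (auto simp: syllable_words_def)
    have ge1: "1 \<le> (case a of (v, s) \<Rightarrow> k v s s)" if "a \<in> set ?w" for a
      using that syl[of "fst a" "snd a"] large[of "fst a" "snd a"] by (simp add: case_prod_unfold)
    have "(\<Sum>a\<leftarrow>?w. (1::real)) \<le> (\<Sum>(v, s)\<leftarrow>?w. k v s s)"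
      by (rule sum_list_mono) (rule ge1)
    then have "real (length ?w) \<le> M" using M by (simp add: sum_list_triv)
    moreover have "set ?w \<subseteq> A"
    proof
      fix a assume a: "a \<in> set ?w"
      have "(case a of (v, s) \<Rightarrow> k v s s) \<le> (\<Sum>(v, s)\<leftarrow>?w. k v s s)"
        by (rule member_le_sum_list) (use a ge1 in \<open>fastforce simp: image_iff\<close>)+
      then show "a \<in> A" using a syl M by (cases a) (auto simp: A_def)
    qed
    ultimately show "g \<in> word_value ` {w. set w \<subseteq> A \<and> length w \<le> nat \<lfloor>M\<rfloor>}"
      using min_word(2)[OF g] by (intro image_eqI[of _ _ ?w]) (auto simp: le_nat_floor)
  qed
  then show "finite {g \<in> carrier \<Gamma>. product_kernel g g \<le> M}"
    by (rule finite_subset[OF _ finite_imageI[OF finite_lists_length_le[OF finite_A]]])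
qed

end

theorem corollary3p6:
  fixes V :: "'v set" and E :: "'v set set" and G :: "'v \<Rightarrow> ('a, 'm) monoid_scheme"
  assumes "simplicial_graph V E" and "countable V"
    and "\<And>v. v \<in> V \<Longrightarrow> haagerup TYPE('h) (G v) (discrete_topology (carrier (G v)))"
  shows "haagerup TYPE(nat \<Rightarrow> real) (graph_product V E G)
    (discrete_topology (carrier (graph_product V E G)))"
proof -
  have lcsc: "lcsc_group (G v) (discrete_topology (carrier (G v)))" if "v \<in> V" for v
    using assms(3)[OF that] by (simp add: haagerup_def)
  have grp: "group (G v)" if "v \<in> V" for v
    using lcsc[OF that] by (simp add: lcsc_group_def)
  have cnt: "countable (carrier (G v))" if "v \<in> V" for v
    using lcsc_group.second_countable[OF lcsc[OF that]] by (simp add: second_countable_discrete_topology)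
  have "\<exists>K. orbit_kernel (G v) K \<and> proper_kernel (G v) K" if "v \<in> V" for v
    by (rule haagerup_imp_proper_orbit_kernel[OF assms(3)[OF that]]) blast
  then obtain K where K: "\<And>v. v \<in> V \<Longrightarrow> orbit_kernel (G v) (K v)"
    and K_proper: "\<And>v. v \<in> V \<Longrightarrow> proper_kernel (G v) (K v)" by metis
  \<comment> \<open>The weights \<open>n v\<close> are at least \<open>1\<close>, which bounds the length of words, and tend to infinity
    along an enumeration of \<open>V\<close>, which bounds the vertices that can occur.\<close>
  define n where "n v = real (to_nat_on V v) + 1" for v
  define k where "k v g h = K v g h + n v * discrete_kernel (G v) g h" for v g h
  have k: "orbit_kernel (G v) (k v)" if "v \<in> V" for v
    unfolding k_def[abs_def]
    by (intro orbit_kernel_add orbit_kernel_scale orbit_kernel_discrete K grp that) (simp add: n_def)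
  interpret graph_of_kernels V E G k
    by (intro graph_of_kernels.intro graph_of_groups.intro graph_of_kernels_axioms.intro assms(1) grp k)
  have k_diag: "k v s s = K v s s + n v" "0 \<le> K v s s"
    if "v \<in> V" "s \<in> carrier (G v)" "s \<noteq> \<one>\<^bsub>G v\<^esub>" for v s
    using that K[OF that(1)] positive_semidefinite_on_diag_nonneg[of "carrier (G v)" "K v" s]
    by (auto simp: k_def discrete_kernel_def orbit_kernel_def)
  have "proper_kernel \<Gamma> product_kernel"
  proof (rule proper_product_kernel)
    show "1 \<le> k v s s" if "v \<in> V" "s \<in> carrier (G v)" "s \<noteq> \<one>\<^bsub>G v\<^esub>" for v s
      using k_diag[OF that] by (simp add: n_def)
    fix M :: real
    define B where "B = {v \<in> V. to_nat_on V v \<le> nat \<lfloor>M\<rfloor>}"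
    have "finite (to_nat_on V ` B)"
      by (rule finite_subset[of _ "{..nat \<lfloor>M\<rfloor>}"]) (auto simp: B_def)
    then have "finite B"
      by (rule finite_imageD) (rule inj_on_subset[OF inj_on_to_nat_on[OF assms(2)]], simp add: B_def)
    then have "finite (SIGMA v:B. {s \<in> carrier (G v). K v s s \<le> M})"
      using K_proper by (intro finite_SigmaI) (auto simp: B_def proper_kernel_def)
    moreover have "{(v, s). v \<in> V \<and> s \<in> carrier (G v) \<and> s \<noteq> \<one>\<^bsub>G v\<^esub> \<and> k v s s \<le> M} \<subseteq>
        (SIGMA v:B. {s \<in> carrier (G v). K v s s \<le> M})"
    proof (clarsimp)
      fix v s assume vs: "v \<in> V" "s \<in> carrier (G v)" "s \<noteq> \<one>\<^bsub>G v\<^esub>" "k v s s \<le> M"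
      then have "real (to_nat_on V v) \<le> M" "K v s s \<le> M"
        using k_diag[OF vs(1-3)] by (simp_all add: n_def)
      then show "v \<in> B \<and> K v s s \<le> M" using vs(1) by (simp add: B_def le_nat_floor)
    qed
    ultimately show "finite {(v, s). v \<in> V \<and> s \<in> carrier (G v) \<and> s \<noteq> \<one>\<^bsub>G v\<^esub> \<and> k v s s \<le> M}"
      by (rule finite_subset[rotated])
  qed
  moreover have "countable (carrier \<Gamma>)"
    unfolding carrier_\<Gamma> syllable_words_def
    using cnt assms(2) by (intro countable_image countable_lists countable_SIGMA) auto
  ultimately show ?thesis
    using orbit_kernel_product_kernel by (intro proper_orbit_kernel_imp_haagerup is_group)
qed

end
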